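(* Let $h \geq 2$ and $m \geq 1$ be integers. (1) For each integer $t>0$, the evaluation $(-1)^{m-1}b_{m,h}(-t)$ equals the total number of rulers of length $t$ with $m+1$ markings, counted with $B_h$-multiplicities. (2) The evaluation $(-1)^{m-1}b_{m,h}(0)$ is the number of combinatorial types of $B_h$-sets with $m+1$ markings.
   Context: A ruler of length $t$ with $m+1$ markings is a sequence of integers $0=x_0<x_1<\cdots<x_{m-1}<x_m=t$. It is a $B_h$-set if for every pair of distinct sequences $0\le r_1\le\cdots\le r_h\le m$ and $0\le s_1\le\cdots\le s_h\le m$ one has $x_{r_1}+\cdots+x_{r_h}\neq x_{s_1}+\cdots+x_{s_h}$. A real $B_h$-set of length $t$ with $m+1$ markings is a sequence of real numbers $0=y_0<y_1<\cdots<y_{m-1}<y_m=t$ satisfying the same condition. For a positive integer $t$, $b_{m,h}(t)$ is the number of $B_h$-sets of length $t$ with $m+1$ markings. The function $b_{m,h}$ is a quasipolynomial in $t$, that is, a function of the form $\sum_i c_i(t)t^i$ (finite sum) with each $c_i$ periodic on the integers. The values $b_{m,h}(-t)$ and $b_{m,h}(0)$ denote evaluations of this quasipolynomial. Two (integral or real) $B_h$-sets $\mathbf{x}$ and $\mathbf{y}$ with $m+1$ markings are combinatorially equivalent if for every pair of distinct sequences $0\le r_1\le\cdots\le r_h\le m$ and $0\le s_1\le\cdots\le s_h\le m$, either the inequality $x_{r_1}+\cdots+x_{r_h}<x_{s_1}+\cdots+x_{s_h}$ holds for both $\mathbf{x}$ and $\mathbf{y}$ (that is, also with each $x$ replaced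 by $y$), or the opposite inequality $>$ holds for both. A combinatorial type is an equivalence class for this relation. The $B_h$-multiplicity of an integral ruler $\mathbf{x}$, $0=x_0<x_1<\cdots<x_{m-1}<x_m=t$, is the number of combinatorial types of real $B_h$-sets $0=y_0<y_1<\cdots<y_{m-1}<y_m=t$ in an $\epsilon$-neighborhood of $\mathbf{x}$, for sufficiently small $\epsilon>0$.
   Formalization: In (1) the rulers counted may have coinciding markings, 0 = x_0 ≤ x_1 ≤ … ≤ x_m = t; with strictly increasing rulers (1) is false, e.g. for m = h = 2, t = 1, where -b(-1) = 2 but no strictly increasing ruler exists. *)

theory Defs
  imports "HOL-Analysis.Analysis"
begin

text \<open>
  A ruler with \<open>m + 1\<close> markings is represented by the list of its markings
  \<open>[x\<^sub>0, \<dots>, x\<^sub>m]\<close>. The type \<open>'a\<close> is used at \<open>int\<close> (integral rulers) and \<open>real\<close>.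
\<close>

definition ruler :: "nat \<Rightarrow> 'a::linordered_idom \<Rightarrow> 'a list \<Rightarrow> bool" where
  "ruler m t x \<longleftrightarrow> length x = m + 1 \<and> x ! 0 = 0 \<and> x ! m = t \<and> sorted_wrt (<) x"

text \<open>
  Rulers whose markings may coincide, \<open>0 = x\<^sub>0 \<le> x\<^sub>1 \<le> \<dots> \<le> x\<^sub>m = t\<close>. The reciprocity law
  has to range over these: the closures of the regions of real \<open>B\<^sub>h\<close>-sets contain such points.
  With only strictly increasing rulers it fails, e.g. for \<open>m = h = 2\<close> and \<open>t = 1\<close>, where
  the quasipolynomial is \<open>t - 1\<close> for odd \<open>t\<close>, so that \<open>(-1) * b (-1) = 2\<close>, but there is
  no strictly increasing integral ruler of length 1 with three markings.
\<close>

definition weak_ruler :: "nat \<Rightarrow> 'a::linordered_idom \<Rightarrow> 'a list \<Rightarrow> bool" where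
  "weak_ruler m t x \<longleftrightarrow> length x = m + 1 \<and> x ! 0 = 0 \<and> x ! m = t \<and> sorted_wrt (\<le>) x"

definition index_seqs :: "nat \<Rightarrow> nat \<Rightarrow> nat list set" where
  "index_seqs m h = {r. length r = h \<and> sorted r \<and> set r \<subseteq> {0..m}}"

definition mark_sum :: "'a::linordered_idom list \<Rightarrow> nat list \<Rightarrow> 'a" where
  "mark_sum x r = (\<Sum>i\<leftarrow>r. x ! i)"

definition Bh_set :: "nat \<Rightarrow> nat \<Rightarrow> 'a::linordered_idom \<Rightarrow> 'a list \<Rightarrow> bool" where
  "Bh_set m h t x \<longleftrightarrow> ruler m t x \<and>
     (\<forall>r\<in>index_seqs m h. \<forall>s\<in>index_seqs m h. r \<noteq> s \<longrightarrow> mark_sum x r \<noteq> mark_sum x s)"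

definition num_Bh_sets :: "nat \<Rightarrow> nat \<Rightarrow> int \<Rightarrow> nat" where
  "num_Bh_sets m h t = card {x :: int list. Bh_set m h t x}"

definition quasipolynomial :: "(int \<Rightarrow> real) \<Rightarrow> bool" where
  "quasipolynomial f \<longleftrightarrow>
     (\<exists>d. \<exists>c :: nat \<Rightarrow> int \<Rightarrow> real.
        (\<forall>i\<le>d. \<exists>p>0. \<forall>t. c i (t + p) = c i t) \<and>
        (\<forall>t. f t = (\<Sum>i\<le>d. c i t * of_int t ^ i)))"

text \<open>
  The quasipolynomial \<open>b\<^bsub>m,h\<^esub>\<close>, determined by the counts at positive \<open>t\<close>. At \<open>t \<le> 0\<close> it is
  in general different from \<open>num_Bh_sets m h t\<close>.
\<close>

definition Bh_quasipoly :: "nat \<Rightarrow> nat \<Rightarrow> int \<Rightarrow> real" where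
  "Bh_quasipoly m h =
     (THE q. quasipolynomial q \<and> (\<forall>t>0. q t = real (num_Bh_sets m h t)))"

text \<open>
  Combinatorial equivalence on real \<open>B\<^sub>h\<close>-sets of arbitrary length; an integral \<open>B\<^sub>h\<close>-set is
  compared with others through its image \<open>map real_of_int x\<close>.
\<close>

definition comb_equiv :: "nat \<Rightarrow> nat \<Rightarrow> (real list \<times> real list) set" where
  "comb_equiv m h = {(x, y). (\<exists>t. Bh_set m h t x) \<and> (\<exists>t. Bh_set m h t y) \<and>
     (\<forall>r\<in>index_seqs m h. \<forall>s\<in>index_seqs m h. r \<noteq> s \<longrightarrow>
        mark_sum x r < mark_sum x s \<and> mark_sum y r < mark_sum y s \<or>
        mark_sum x r > mark_sum x s \<and> mark_sum y r > mark_sum y s)}"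

text \<open>
  For a set \<open>A\<close> of real \<open>B\<^sub>h\<close>-sets, \<open>A // comb_equiv m h\<close> is the set of full equivalence
  classes that meet \<open>A\<close>.
\<close>

definition comb_types :: "nat \<Rightarrow> nat \<Rightarrow> real list set \<Rightarrow> real list set set" where
  "comb_types m h A = A // comb_equiv m h"

definition Bh_sets_near :: "nat \<Rightarrow> nat \<Rightarrow> int \<Rightarrow> int list \<Rightarrow> real \<Rightarrow> real list set" where
  "Bh_sets_near m h t x \<epsilon> =
     {y. Bh_set m h (real_of_int t) y \<and> L2_set (\<lambda>i. y ! i - real_of_int (x ! i)) {0..m} < \<epsilon>}"

definition Bh_multiplicity :: "nat \<Rightarrow> nat \<Rightarrow> int \<Rightarrow> int list \<Rightarrow> nat" where
  "Bh_multiplicity m h t x =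
     (THE n. \<forall>\<^sub>F \<epsilon> in at_right 0. card (comb_types m h (Bh_sets_near m h t x \<epsilon>)) = n)"

end

theory Submission
  imports Defs
begin

text \<open>
  In terms of the gaps between consecutive markings, the combinatorial types are the chambers of a
  rational central arrangement inside the positive orthant, and the length is the sum of the gaps.
  Counting lattice points of an open chamber on the hyperplane of height \<open>t\<close> gives a quasipolynomial
  whose value at \<open>- t\<close> is, up to the sign, the number of lattice points of height \<open>t\<close> in the closed
  chamber (Ehrhart reciprocity). The multiplicity of a ruler is the number of closed chambers
  containing it, so summing over the chambers gives (1); at height 0 every closed chamber contains
  only the origin, which gives (2).

  For the reciprocity, a generic point \<open>p\<close> of the chamber decides which points of a hyperplane belong
  to which side. Cutting along edges, the chamber becomes a disjoint union of half-open simplicial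
  cones, and passing from the closed to the open chamber replaces \<open>p\<close> by \<open>- p\<close>. In a half-open
  simplicial cone every lattice point is uniquely a point of the half-open fundamental box plus a
  nonnegative integral combination of the generators, so the count is a sum of binomial
  coefficients, and the point reflection of the box exchanges \<open>p\<close> and \<open>- p\<close>.
\<close>

section \<open>Quasipolynomials\<close>

lemma periodic_mult:
  fixes c :: "int \<Rightarrow> real"
  assumes "\<And>t. c (t + p) = c t"
  shows "c (t + k * p) = c t"
proof (induction k rule: int_induct [where k = 0])
  case (step1 i)
  have "c (t + (i + 1) * p) = c ((t + i * p) + p)" by (simp add: algebra_simps)
  then show ?case using assms step1 by simp
next
  case (step2 i)
  have "c (t + i * p) = c ((t + (i - 1) * p) + p)" by (simp add: algebra_simps)
  then show ?case using assms step2 by simp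
qed simp

lemma periodic_mod:
  fixes c :: "int \<Rightarrow> real"
  assumes "\<And>t. c (t + p) = c t" "p dvd D"
  shows "c (t mod D) = c t"
proof -
  obtain e where e: "D = p * e" using assms(2) by blast
  have "c (t mod D + (t div D * e) * p) = c (t mod D)"
    by (rule periodic_mult) (rule assms(1))
  moreover have "t mod D + (t div D * e) * p = t"
  proof -
    have "t mod D + (t div D * e) * p = t div D * D + t mod D" unfolding e by (simp add: algebra_simps)
    then show ?thesis by (simp only: div_mult_mod_eq)
  qed
  ultimately show ?thesis by simp
qed

text \<open>The product of the periods is a period of every coefficient. In this form a
  quasipolynomial is one ordinary polynomial on each residue class, so sums and uniqueness become
  matters of polynomials.\<close>

lemma quasipolynomial_iff_poly:
  "quasipolynomial f \<longleftrightarrow>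
    (\<exists>D>0. \<exists>P :: int \<Rightarrow> real poly. \<forall>t. f t = poly (P (t mod D)) (of_int t))"
proof
  assume "quasipolynomial f"
  then obtain d c where per: "\<forall>i\<le>d. \<exists>p>0. \<forall>t. c i (t + p) = c i t"
    and f: "\<forall>t. f t = (\<Sum>i\<le>d. c i t * of_int t ^ i)" unfolding quasipolynomial_def by auto
  from per obtain p where p: "\<And>i. i \<le> d \<Longrightarrow> p i > 0 \<and> (\<forall>t. c i (t + p i) = c i t)" by metis
  define D where "D = (\<Prod>i\<le>d. p i)"
  have D: "D > 0" unfolding D_def using p by (intro prod_pos) auto
  have "c i (t mod D) = c i t" if "i \<le> d" for i t
  proof (rule periodic_mod)
    show "c i (s + p i) = c i s" for s using p[OF that] by blast
    show "p i dvd D" unfolding D_def by (rule dvd_prodI) (use that in auto)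
  qed
  then have "f t = poly (\<Sum>i\<le>d. monom (c i (t mod D)) i) (of_int t)" for t
    by (simp add: f poly_sum poly_monom)
  then show "\<exists>D>0. \<exists>P :: int \<Rightarrow> real poly. \<forall>t. f t = poly (P (t mod D)) (of_int t)"
    using D by (intro exI[of _ D] conjI exI[of _ "\<lambda>r. \<Sum>i\<le>d. monom (c i r) i"]) auto
next
  assume "\<exists>D>0. \<exists>P :: int \<Rightarrow> real poly. \<forall>t. f t = poly (P (t mod D)) (of_int t)"
  then obtain D P where D: "D > 0" and f: "\<And>t. f t = poly (P (t mod D)) (of_int t)" by blast
  \<comment> \<open>One degree bound for all residues, since the definition has a single summation
    range.\<close>
  define d where "d = Max ((\<lambda>r. degree (P r)) ` {0..<D})"
  have deg: "degree (P (t mod D)) \<le> d" for t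
    unfolding d_def using D by (intro Max_ge) auto
  have "f t = (\<Sum>i\<le>d. coeff (P (t mod D)) i * of_int t ^ i)" for t
    unfolding f poly_altdef using deg[of t]
    by (intro sum.mono_neutral_left) (auto simp: coeff_eq_0)
  then show "quasipolynomial f"
    unfolding quasipolynomial_def using D
    by (intro exI[of _ d] exI[of _ "\<lambda>i t. coeff (P (t mod D)) i"]) (auto intro!: exI[of _ D])
qed

lemma quasipolynomial_zero: "quasipolynomial (\<lambda>t. 0)"
  unfolding quasipolynomial_iff_poly by (intro exI[of _ 1] conjI exI[of _ "\<lambda>_. 0"]) auto

lemma quasipolynomial_add:
  assumes "quasipolynomial f" "quasipolynomial g"
  shows "quasipolynomial (\<lambda>t. f t + g t)"
proof -
  obtain D P where D: "D > 0" and f: "\<And>t. f t = poly (P (t mod D)) (of_int t)"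
    using assms(1) unfolding quasipolynomial_iff_poly by blast
  obtain E Q where E: "E > 0" and g: "\<And>t. g t = poly (Q (t mod E)) (of_int t)"
    using assms(2) unfolding quasipolynomial_iff_poly by blast
  show ?thesis unfolding quasipolynomial_iff_poly
    by (intro exI[of _ "D * E"] conjI exI[of _ "\<lambda>r. P (r mod D) + Q (r mod E)"])
       (use D E in \<open>auto simp: f g mod_mod_cancel\<close>)
qed

lemma quasipolynomial_uminus:
  assumes "quasipolynomial f"
  shows "quasipolynomial (\<lambda>t. - f t)"
proof -
  obtain D P where D: "D > 0" and f: "\<And>t. f t = poly (P (t mod D)) (of_int t)"
    using assms(1) unfolding quasipolynomial_iff_poly by blast
  show ?thesis unfolding quasipolynomial_iff_poly
    by (intro exI[of _ "D"] conjI exI[of _ "\<lambda>r. - P r"]) (use D in \<open>auto simp: f\<close>)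
qed

lemma quasipolynomial_sum:
  assumes "\<And>a. a \<in> A \<Longrightarrow> quasipolynomial (f a)"
  shows "quasipolynomial (\<lambda>t. \<Sum>a\<in>A. f a t)"
  using assms
  by (induction A rule: infinite_finite_induct)
     (auto intro: quasipolynomial_zero quasipolynomial_add)

text \<open>Every residue class, also that of a negative \<open>t\<close>, contains infinitely many
  positive integers. These are too many roots for a nonzero polynomial.\<close>

lemma quasipolynomial_eq_0:
  assumes "quasipolynomial f" "\<And>t. t > 0 \<Longrightarrow> f t = 0"
  shows "f t = 0"
proof -
  obtain D P where D: "D > 0" and f: "\<And>t. f t = poly (P (t mod D)) (of_int t)"
    using assms(1) unfolding quasipolynomial_iff_poly by blast
  \<comment> \<open>The shift by a multiple of \<open>D\<close> keeps the residue, and it exceeds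
    \<open>\<bar>t\<bar>\<close> because \<open>D \<ge> 1\<close>.\<close>
  have "poly (P (t mod D)) (of_int (t + (\<bar>t\<bar> + 1 + int k) * D)) = 0" for k
  proof -
    have "\<bar>t\<bar> + 1 \<le> (\<bar>t\<bar> + 1 + int k) * 1" by simp
    also have "\<dots> \<le> (\<bar>t\<bar> + 1 + int k) * D" using D by (intro mult_left_mono) auto
    finally have "t + (\<bar>t\<bar> + 1 + int k) * D > 0" by linarith
    then show ?thesis using assms(2) f by (metis mod_mult_self1)
  qed
  then have "range (\<lambda>k. of_int (t + (\<bar>t\<bar> + 1 + int k) * D)) \<subseteq> {x. poly (P (t mod D)) x = 0}"
    by blast
  moreover have "infinite (range (\<lambda>k. real_of_int (t + (\<bar>t\<bar> + 1 + int k) * D)))"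
    by (rule range_inj_infinite) (use D in \<open>auto intro!: injI\<close>)
  ultimately have "P (t mod D) = 0" using poly_roots_finite finite_subset by blast
  then show ?thesis using f by simp
qed

text \<open>This justifies the definite description in \<open>Bh_quasipoly\<close>.\<close>

lemma quasipolynomial_unique:
  assumes "quasipolynomial f" "quasipolynomial g" "\<And>t. t > 0 \<Longrightarrow> f t = g t"
  shows "f = g"
proof
  fix t
  have "f t + - g t = 0"
    using quasipolynomial_add[OF assms(1) quasipolynomial_uminus[OF assms(2)]]
    by (rule quasipolynomial_eq_0) (simp add: assms(3))
  then show "f t = g t" by simp
qed

text \<open>A generalized binomial coefficient with fixed lower index is a polynomial in the upper
  argument; the divisibility test selects one residue class.\<close>

lemma quasipolynomial_gbinomial:
  fixes D a :: int
  assumes "D > 0"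
  shows "quasipolynomial (\<lambda>t. if D dvd t - a
    then (of_int (t - a) / of_int D + e) gchoose k else 0)"
proof -
  define P :: "real poly" where
    "P = smult (1 / fact k) (\<Prod>i = 0..<k. [: - of_int a / of_int D + e - of_nat i, 1 / of_int D :])"
  have P: "poly P (of_int t) = (of_int (t - a) / of_int D + e) gchoose k" for t
    unfolding P_def by (simp add: gbinomial_prod_rev poly_prod diff_divide_distrib algebra_simps)
  have dvd: "D dvd t mod D - a \<longleftrightarrow> D dvd t - a" for t
    by (metis mod_eq_dvd_iff mod_mod_trivial)
  show ?thesis unfolding quasipolynomial_iff_poly
    by (intro exI[of _ D] conjI exI[of _ "\<lambda>r. if D dvd r - a then P else 0"])
       (use assms in \<open>auto simp: P dvd\<close>)
qed

section \<open>Half-open simplicial cones\<close>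

definition ev :: "nat \<Rightarrow> (nat \<Rightarrow> real) \<Rightarrow> (nat \<Rightarrow> real) \<Rightarrow> real" where
  "ev m c x = (\<Sum>k<m. c k * x k)"

text \<open>Coordinates from \<open>m\<close> on are fixed at 0, so that points agreeing below
  \<open>m\<close> are equal as functions and are counted once.\<close>

definition lattice :: "nat \<Rightarrow> (nat \<Rightarrow> real) set" where
  "lattice m = {z. (\<forall>k<m. z k \<in> \<int>) \<and> (\<forall>k\<ge>m. z k = 0)}"

text \<open>
  Positivity at the point \<open>x + \<epsilon> p\<close> for infinitesimal \<open>\<epsilon> > 0\<close>. For a direction \<open>p\<close> on which no
  relevant form vanishes, \<open>lex_pos m p\<close> makes every hyperplane belong to exactly one of its sides.
\<close>

definition lex_pos :: "nat \<Rightarrow> (nat \<Rightarrow> real) \<Rightarrow> (nat \<Rightarrow> real) \<Rightarrow> (nat \<Rightarrow> real) \<Rightarrow> bool" where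
  "lex_pos m p c x \<longleftrightarrow> ev m c x > 0 \<or> ev m c x = 0 \<and> ev m c p > 0"

definition points :: "nat \<Rightarrow> (nat \<Rightarrow> real) \<Rightarrow> (nat \<Rightarrow> real) set \<Rightarrow> int \<Rightarrow> (nat \<Rightarrow> real) set" where
  "points m p F t =
    {z \<in> lattice m. (\<forall>c\<in>F. lex_pos m p c z) \<and> (\<Sum>k<m. z k) = of_int t}"

text \<open>
  When all forms in \<open>F\<close> are positive at \<open>p\<close>, the direction \<open>p\<close> selects the closed cone and \<open>- p\<close> the
  open one. The general half-open version is the one that is additive under subdivision.
\<close>

definition reciprocal :: "nat \<Rightarrow> (nat \<Rightarrow> real) \<Rightarrow> (nat \<Rightarrow> real) set \<Rightarrow> bool" where
  "reciprocal m p F \<longleftrightarrow> (\<exists>q. quasipolynomial q \<and>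
     (\<forall>t>0. q t = real (card (points m (- p) F t))) \<and>
     (\<forall>t\<ge>0. real (card (points m p F t)) = (-1) ^ (m - 1) * q (- t)))"

section \<open>Bilinearity of \<open>ev\<close>, lattice operations and compositions\<close>

lemma ev_add: "ev m c (\<lambda>k. x k + y k) = ev m c x + ev m c y"
  by (simp add: ev_def algebra_simps sum.distrib)

lemma ev_diff: "ev m c (\<lambda>k. x k - y k) = ev m c x - ev m c y"
  by (simp add: ev_def algebra_simps sum_subtractf)

lemma ev_scale: "ev m c (\<lambda>k. a * x k) = a * ev m c x"
  by (simp add: ev_def algebra_simps sum_distrib_left)

lemma ev_uminus: "ev m c (- x) = - ev m c x"
  by (simp add: ev_def sum_negf)

lemma ev_sum: "ev m c (\<lambda>k. \<Sum>i\<in>A. f i k) = (\<Sum>i\<in>A. ev m c (f i))"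
  by (induction A rule: infinite_finite_induct) (auto simp: ev_add, simp_all add: ev_def)

lemma ev_add_left: "ev m (\<lambda>k. c k + d k) x = ev m c x + ev m d x"
  by (simp add: ev_def algebra_simps sum.distrib)

lemma ev_diff_left: "ev m (\<lambda>k. c k - d k) x = ev m c x - ev m d x"
  by (simp add: ev_def algebra_simps sum_subtractf)

lemma ev_scale_left: "ev m (\<lambda>k. a * c k) x = a * ev m c x"
  by (simp add: ev_def algebra_simps sum_distrib_left)

lemma ev_uminus_left: "ev m (- c) x = - ev m c x"
  by (simp add: ev_def sum_negf)

lemma ev_cong: "(\<And>k. k < m \<Longrightarrow> c k = d k) \<Longrightarrow> (\<And>k. k < m \<Longrightarrow> x k = y k) \<Longrightarrow> ev m c x = ev m d y"
  by (simp add: ev_def)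

lemma lattice_add: "x \<in> lattice m \<Longrightarrow> y \<in> lattice m \<Longrightarrow> (\<lambda>k. x k + y k) \<in> lattice m"
  by (simp add: lattice_def)

lemma lattice_diff: "x \<in> lattice m \<Longrightarrow> y \<in> lattice m \<Longrightarrow> (\<lambda>k. x k - y k) \<in> lattice m"
  by (simp add: lattice_def)

lemma lattice_sum: "(\<And>i. i \<in> A \<Longrightarrow> f i \<in> lattice m) \<Longrightarrow> (\<lambda>k. \<Sum>i\<in>A. f i k) \<in> lattice m"
  by (auto simp: lattice_def intro!: Ints_sum)

lemma lattice_scale: "n \<in> \<int> \<Longrightarrow> x \<in> lattice m \<Longrightarrow> (\<lambda>k. n * x k) \<in> lattice m"
  by (simp add: lattice_def)

lemma finite_lattice_bounded:
  assumes "\<And>z k. z \<in> A \<Longrightarrow> k < m \<Longrightarrow> \<bar>z k\<bar> \<le> B"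
  shows "finite (A \<inter> lattice m)"
proof -
  have "A \<inter> lattice m \<subseteq> (\<lambda>f k. if k < m then real_of_int (f k) else 0) `
      (PiE {..<m} (\<lambda>_. {- \<lceil>B\<rceil>..\<lceil>B\<rceil>}))" (is "_ \<subseteq> ?g ` ?S")
  proof
    fix z assume z: "z \<in> A \<inter> lattice m"
    define f where "f = restrict (\<lambda>k. \<lfloor>z k\<rfloor>) {..<m}"
    have f: "real_of_int (f k) = z k" if "k < m" for k
      using z that by (auto simp: f_def lattice_def)
    have "f k \<in> {- \<lceil>B\<rceil>..\<lceil>B\<rceil>}" if "k < m" for k
    proof -
      have "\<bar>real_of_int (f k)\<bar> \<le> B" using assms[of z k] z that f by auto
      then show ?thesis by (simp add: abs_le_iff) linarith
    qed
    then have "f \<in> ?S" by (auto simp: f_def PiE_iff)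
    moreover have "z = ?g f" using z by (auto simp: f lattice_def)
    ultimately show "z \<in> ?g ` ?S" by blast
  qed
  then show ?thesis by (rule finite_subset) (auto intro: finite_PiE)
qed

text \<open>
  The gbinomial on the right vanishes for \<open>- m < s / D < 0\<close>, so the formula stays valid
  slightly below 0.
\<close>

lemma card_compositions:
  fixes D s :: int
  assumes "D > 0" "m \<ge> 1" "s > - (int m * D)"
  shows "real (card {ks. length ks = m \<and> D * int (sum_list ks) = s}) =
    (if D dvd s then (of_int s / of_int D + real (m - 1)) gchoose (m - 1) else 0)"
proof (cases "D dvd s")
  case False
  then have none: "{ks. length ks = m \<and> D * int (sum_list ks) = s} = {}" by auto
  show ?thesis unfolding none using False by simp
next
  case True
  then obtain n where n: "s = D * n" by blast
  have "D * (- int m) < D * n" using assms(3) n by (simp add: algebra_simps)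
  then have nm: "- int m < n" using assms(1) by (simp only: mult_less_cancel_left_pos)
  have quot: "real_of_int s / real_of_int D = of_int n" using n assms(1) by simp
  have arg: "real_of_int n + real (m - 1) = real (nat (n + int m - 1))"
    using nm assms(2) by (simp add: of_nat_diff)
  have set: "{ks. length ks = m \<and> D * int (sum_list ks) = s} =
      (if n \<ge> 0 then {ks. length ks = m \<and> sum_list ks = nat n} else {})"
    using assms(1) n by (auto simp: mult_less_0_iff)
  show ?thesis
  proof (cases "n \<ge> 0")
    case True
    have "nat (n + int m - 1) = nat n + m - 1" using True assms(2) by linarith
    moreover have "(nat n + m - 1) choose nat n = (nat n + m - 1) choose (m - 1)"
      using assms(2) by (subst binomial_symmetric) auto
    ultimately show ?thesis
      using \<open>D dvd s\<close> True unfolding quot arg set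
      by (simp add: card_length_sum_list binomial_gbinomial)
  next
    case False
    then have "nat (n + int m - 1) < m - 1" using assms(2) nm by linarith
    then show ?thesis
      using False \<open>D dvd s\<close> unfolding quot arg set by (simp flip: binomial_gbinomial)
  qed
qed

text \<open>
  The vectors \<open>v 0, \<dots>, v (m - 1)\<close> generate the cone, \<open>l 0, \<dots>, l (m - 1)\<close> is the dual basis. The last
  assumption says that all generators have coordinate sum 1.
\<close>

locale simplicial_cone =
  fixes m :: nat and l v :: "nat \<Rightarrow> nat \<Rightarrow> real"
  assumes m: "m \<ge> 1"
    and l_Rats: "\<And>i k. i < m \<Longrightarrow> k < m \<Longrightarrow> l i k \<in> \<rat>"
    and v_Rats: "\<And>i k. i < m \<Longrightarrow> k < m \<Longrightarrow> v i k \<in> \<rat>"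
    and dual: "\<And>i j. i < m \<Longrightarrow> j < m \<Longrightarrow> ev m (l i) (v j) = (if i = j then 1 else 0)"
    and total: "\<And>a b. a < m \<Longrightarrow> b < m \<Longrightarrow> (\<Sum>i<m. l i a * v i b) = (if a = b then 1 else 0)"
    and height: "\<And>k. k < m \<Longrightarrow> (\<Sum>i<m. l i k) = 1"
begin

text \<open>\<open>height\<close> says that the dual forms add up to the coordinate-sum
  form.\<close>

lemma sum_eq_sum_ev: "(\<Sum>k<m. x k) = (\<Sum>i<m. ev m (l i) x)"
proof -
  have "(\<Sum>i<m. ev m (l i) x) = (\<Sum>k<m. (\<Sum>i<m. l i k) * x k)"
    unfolding ev_def by (subst sum.swap) (simp add: sum_distrib_right)
  also have "\<dots> = (\<Sum>k<m. x k)" by (simp add: height)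
  finally show ?thesis by simp
qed

text \<open>\<open>total\<close> is the resolution of the identity by a basis and its dual.\<close>

lemma expand: "k < m \<Longrightarrow> x k = (\<Sum>i<m. ev m (l i) x * v i k)"
proof -
  assume k: "k < m"
  have "(\<Sum>i<m. ev m (l i) x * v i k) = (\<Sum>a<m. (\<Sum>i<m. l i a * v i k) * x a)"
    unfolding ev_def sum_distrib_right by (subst sum.swap) (simp add: algebra_simps)
  also have "\<dots> = (\<Sum>a<m. if a = k then x a else 0)"
    by (intro sum.cong) (auto simp: total k)
  finally show ?thesis using k by simp
qed

lemma ev_expand: "ev m c x = (\<Sum>i<m. ev m c (v i) * ev m (l i) x)"
proof -
  have "ev m c x = ev m c (\<lambda>k. \<Sum>i<m. ev m (l i) x * v i k)"
    by (rule ev_cong) (simp_all flip: expand)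
  then show ?thesis by (simp add: ev_sum ev_scale mult.commute[of _ "ev m c _"])
qed

lemma finite_ev_bounded:
  assumes "\<And>z i. z \<in> A \<Longrightarrow> i < m \<Longrightarrow> \<bar>ev m (l i) z\<bar> \<le> B"
  shows "finite (A \<inter> lattice m)"
proof (cases "A = {}")
  case False
  then have B: "B \<ge> 0" using assms[of _ 0] m by fastforce
  show ?thesis
  proof (rule finite_lattice_bounded)
    fix z k assume z: "z \<in> A" and k: "k < m"
    have "\<bar>z k\<bar> \<le> (\<Sum>i<m. \<bar>ev m (l i) z * v i k\<bar>)"
      by (subst expand[OF k]) (rule sum_abs)
    also have "\<dots> \<le> (\<Sum>i<m. B * \<bar>v i k\<bar>)"
      by (intro sum_mono) (auto simp: abs_mult intro!: mult_right_mono assms z)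
    also have "\<dots> \<le> (\<Sum>k<m. \<Sum>i<m. B * \<bar>v i k\<bar>)"
      by (rule member_le_sum[of k "{..<m}" "\<lambda>k. \<Sum>i<m. B * \<bar>v i k\<bar>"])
         (use B k in \<open>auto intro: sum_nonneg\<close>)
    finally show "\<bar>z k\<bar> \<le> (\<Sum>k<m. \<Sum>i<m. B * \<bar>v i k\<bar>)" .
  qed
qed simp

text \<open>On these points the \<open>l i\<close> are nonnegative and add up to \<open>t\<close>,
  so each of them lies between 0 and \<open>t\<close>.\<close>

lemma finite_points:
  assumes "l ` {..<m} \<subseteq> F"
  shows "finite (points m p F t)"
proof -
  have "finite (points m p F t \<inter> lattice m)"
  proof (rule finite_ev_bounded)
    fix z i assume z: "z \<in> points m p F t" and i: "i < m"
    have nn: "ev m (l j) z \<ge> 0" if "j < m" for j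
      using z assms that by (force simp: points_def lex_pos_def)
    have "ev m (l i) z \<le> (\<Sum>i<m. ev m (l i) z)"
      by (rule member_le_sum) (use nn i in auto)
    also have "\<dots> = of_int t" using z by (simp flip: sum_eq_sum_ev add: points_def)
    finally show "\<bar>ev m (l i) z\<bar> \<le> of_int t" using nn[OF i] by simp
  qed
  moreover have "points m p F t \<inter> lattice m = points m p F t" by (auto simp: points_def)
  ultimately show ?thesis by simp
qed

end

section \<open>Tiling a half-open simplicial cone by translates of a box\<close>

locale scaled_simplicial_cone = simplicial_cone +
  fixes D :: int
  assumes D: "D > 0"
    and D_v: "\<And>i k. i < m \<Longrightarrow> k < m \<Longrightarrow> of_int D * v i k \<in> \<int>"
begin

text \<open>Lattice vectors on the rays of the cone, all of height \<open>D\<close>. The cut-off at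
  \<open>m\<close> is what \<open>lattice m\<close> demands.\<close>

definition u :: "nat \<Rightarrow> nat \<Rightarrow> real" where
  "u i k = (if k < m then of_int D * v i k else 0)"

text \<open>Facets visible from \<open>p\<close> are excluded, so that translates of the box tile the half-open cone.\<close>

definition box :: "(nat \<Rightarrow> real) \<Rightarrow> (nat \<Rightarrow> real) set" where
  "box p = {b \<in> lattice m. \<forall>i<m. if ev m (l i) p > 0
     then 0 \<le> ev m (l i) b \<and> ev m (l i) b < of_int D
     else 0 < ev m (l i) b \<and> ev m (l i) b \<le> of_int D}"

text \<open>The coordinate sum of a lattice point is already an integer; the floor only changes its
  type.\<close>

definition ht :: "(nat \<Rightarrow> real) \<Rightarrow> int" where
  "ht b = \<lfloor>\<Sum>k<m. b k\<rfloor>"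

text \<open>The summand for \<open>b\<close> is the number of ways to write
  \<open>(t - ht b) / D\<close> as an ordered sum of \<open>m\<close> naturals, in the polynomial
  form that also makes sense for negative \<open>t\<close>.\<close>

definition count :: "(nat \<Rightarrow> real) \<Rightarrow> int \<Rightarrow> real" where
  "count p t = (\<Sum>b\<in>box p. if D dvd t - ht b
     then (of_int (t - ht b) / of_int D + real (m - 1)) gchoose (m - 1) else 0)"

lemma quasipolynomial_count: "quasipolynomial (count p)"
  unfolding count_def by (intro quasipolynomial_sum quasipolynomial_gbinomial D)

lemma u_lattice: "i < m \<Longrightarrow> u i \<in> lattice m"
  by (auto simp: lattice_def u_def D_v)

lemma ev_u: "i < m \<Longrightarrow> j < m \<Longrightarrow> ev m (l i) (u j) = (if i = j then of_int D else 0)"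
proof -
  assume "i < m" "j < m"
  have "ev m (l i) (u j) = ev m (l i) (\<lambda>k. of_int D * v j k)"
    by (rule ev_cong) (auto simp: u_def)
  then show ?thesis using \<open>i < m\<close> \<open>j < m\<close> by (simp add: ev_scale dual)
qed

lemma ev_comb: "i < m \<Longrightarrow> ev m (l i) (\<lambda>k. \<Sum>j<m. a j * u j k) = of_int D * a i"
  by (simp add: ev_sum ev_scale ev_u if_distrib cong: if_cong)

lemma sum_comb: "(\<Sum>k<m. \<Sum>j<m. a j * u j k) = of_int D * (\<Sum>j<m. a j)"
  by (subst sum_eq_sum_ev) (simp add: ev_comb sum_distrib_left)

lemma of_int_ht: "b \<in> lattice m \<Longrightarrow> of_int (ht b) = (\<Sum>k<m. b k)"
proof -
  assume "b \<in> lattice m"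
  then have "(\<Sum>k<m. b k) \<in> \<int>" by (auto simp: lattice_def intro!: Ints_sum)
  then show ?thesis by (auto simp: ht_def elim: Ints_cases)
qed

lemma box_bounds:
  assumes "b \<in> box p" "i < m"
  shows "ev m (l i) p > 0 \<Longrightarrow> 0 \<le> ev m (l i) b \<and> ev m (l i) b < of_int D"
    and "\<not> ev m (l i) p > 0 \<Longrightarrow> 0 < ev m (l i) b \<and> ev m (l i) b \<le> of_int D"
  using assms by (auto simp: box_def split: if_splits)

lemma finite_box: "finite (box p)"
proof -
  have "finite (box p \<inter> lattice m)"
    by (rule finite_ev_bounded[where B = "of_int D"]) (auto simp: box_def split: if_splits)
  moreover have "box p \<inter> lattice m = box p" by (auto simp: box_def)
  ultimately show ?thesis by simp
qed

text \<open>These bounds keep \<open>t - ht b\<close> above \<open>- (int m * D)\<close>, as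
  \<open>card_compositions\<close> requires: the first for \<open>t > 0\<close>, the strict one for
  \<open>t = 0\<close>.\<close>

lemma ht_box:
  assumes "b \<in> box p"
  shows "ht b \<le> int m * D" "\<exists>i<m. ev m (l i) p > 0 \<Longrightarrow> ht b < int m * D"
proof -
  have le: "ev m (l i) b \<le> of_int D" if "i < m" for i
    using assms that by (auto simp: box_def split: if_splits)
  have ht: "of_int (ht b) = (\<Sum>i<m. ev m (l i) b)"
    using assms by (simp add: of_int_ht box_def flip: sum_eq_sum_ev)
  have "real_of_int (ht b) \<le> (\<Sum>i<m. of_int D)"
    unfolding ht by (rule sum_mono) (use le in auto)
  then have "real_of_int (ht b) \<le> real_of_int (int m * D)" by simp
  then show "ht b \<le> int m * D" by (simp only: of_int_le_iff)
  assume "\<exists>i<m. ev m (l i) p > 0"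
  then obtain i where i: "i < m" "ev m (l i) p > 0" by blast
  then have "ev m (l i) b < of_int D" using assms by (auto simp: box_def)
  then have "real_of_int (ht b) < (\<Sum>i<m. of_int D)"
    unfolding ht by (intro sum_strict_mono_ex1) (use le i in auto)
  then have "real_of_int (ht b) < real_of_int (int m * D)" by simp
  then show "ht b < int m * D" by (simp only: of_int_less_iff)
qed

definition decomp :: "int \<Rightarrow> (nat \<Rightarrow> real) \<Rightarrow> nat list set" where
  "decomp t b = {ks. length ks = m \<and> D * int (sum_list ks) = t - ht b}"

definition assemble :: "(nat \<Rightarrow> real) \<times> nat list \<Rightarrow> nat \<Rightarrow> real" where
  "assemble = (\<lambda>(b, ks) k. b k + (\<Sum>i<m. real (ks ! i) * u i k))"

lemma ev_assemble: "i < m \<Longrightarrow> ev m (l i) (assemble (b, ks)) = ev m (l i) b + of_int D * real (ks ! i)"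
  by (simp add: assemble_def ev_add ev_comb)

text \<open>In each coordinate two box points lie in the same half-open interval of length
  \<open>D\<close>, so they differ by less than \<open>D\<close>, whereas different multiplicities
  contribute at least \<open>D\<close>.\<close>

lemma inj_assemble: "inj_on assemble (SIGMA b:box p. decomp t b)"
proof (rule inj_onI, clarify)
  fix b ks b' ks'
  assume b: "b \<in> box p" "ks \<in> decomp t b" and b': "b' \<in> box p" "ks' \<in> decomp t b'"
    and eq: "assemble (b, ks) = assemble (b', ks')"
  have "ks ! i = ks' ! i" if i: "i < m" for i
  proof -
    have "ev m (l i) b + of_int D * real (ks ! i) = ev m (l i) b' + of_int D * real (ks' ! i)"
      using ev_assemble[OF i] eq by metis
    then have "ev m (l i) b' - ev m (l i) b = of_int D * (real (ks ! i) - real (ks' ! i))"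
      by (simp add: algebra_simps)
    moreover have "\<bar>ev m (l i) b' - ev m (l i) b\<bar> < of_int D"
      using box_bounds[OF b(1) i] box_bounds[OF b'(1) i] by (cases "ev m (l i) p > 0") auto
    ultimately have "of_int D * \<bar>real (ks ! i) - real (ks' ! i)\<bar> < of_int D * 1"
      using D by (simp add: abs_mult)
    then have "\<bar>real (ks ! i) - real (ks' ! i)\<bar> < 1"
      using D by (subst (asm) mult_less_cancel_left_pos) auto
    then show ?thesis by linarith
  qed
  then have ks: "ks = ks'" using b b' by (auto simp: decomp_def intro: nth_equalityI)
  moreover have "b = b'"
  proof
    fix k show "b k = b' k" using fun_cong[OF eq, of k] ks by (simp add: assemble_def)
  qed
  ultimately show "b = b' \<and> ks = ks'" by simp
qed

text \<open>Division with remainder by \<open>D\<close> in each coordinate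
  \<open>ev m (l i) z\<close>: the quotients form \<open>ks\<close>, the remainders determine the
  box point.\<close>

lemma assemble_image: "assemble ` (SIGMA b:box p. decomp t b) = points m p (l ` {..<m}) t"
proof
  show "assemble ` (SIGMA b:box p. decomp t b) \<subseteq> points m p (l ` {..<m}) t"
  proof clarify
    fix b ks assume b: "b \<in> box p" and ks: "ks \<in> decomp t b"
    have "assemble (b, ks) \<in> lattice m"
      using b unfolding assemble_def prod.case
      by (intro lattice_add lattice_sum lattice_scale u_lattice) (auto simp: box_def)
    moreover have "lex_pos m p (l i) (assemble (b, ks))" if i: "i < m" for i
    proof -
      have "of_int D * real (ks ! i) \<ge> 0" using D by simp
      then show ?thesis using box_bounds[OF b i] unfolding lex_pos_def ev_assemble[OF i]
        by (cases "ev m (l i) p > 0") linarith+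
    qed
    moreover have "(\<Sum>k<m. assemble (b, ks) k) = of_int t"
    proof -
      have "sum_list ks = (\<Sum>i<m. ks ! i)"
        using ks by (simp add: decomp_def sum_list_sum_nth lessThan_atLeast0)
      then have "(\<Sum>k<m. assemble (b, ks) k) = of_int (ht b) + of_int (D * int (sum_list ks))"
        using b by (simp add: assemble_def sum.distrib sum_comb of_int_ht box_def)
      also have "\<dots> = of_int t" using ks by (simp add: decomp_def)
      finally show ?thesis .
    qed
    ultimately show "assemble (b, ks) \<in> points m p (l ` {..<m}) t" by (auto simp: points_def)
  qed
next
  show "points m p (l ` {..<m}) t \<subseteq> assemble ` (SIGMA b:box p. decomp t b)"
  proof
    fix z assume z: "z \<in> points m p (l ` {..<m}) t"
    define e where "e i = ev m (l i) z / of_int D" for i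
    \<comment> \<open>Subtracting \<open>\<lfloor>e i\<rfloor>\<close> leaves a remainder in [0, 1),
      subtracting \<open>\<lceil>e i\<rceil> - 1\<close> one in (0, 1], matching the two cases of
      \<open>box\<close>.\<close>
    define n where "n i = (if ev m (l i) p > 0 then \<lfloor>e i\<rfloor> else \<lceil>e i\<rceil> - 1)" for i
    define ks where "ks = map (\<lambda>i. nat (n i)) [0..<m]"
    define b where "b = (\<lambda>k. z k - (\<Sum>i<m. real (ks ! i) * u i k))"
    have ez: "ev m (l i) z = of_int D * e i" for i using D by (simp add: e_def)
    have lp: "lex_pos m p (l i) z" if "i < m" for i using z that by (auto simp: points_def)
    have ks_n: "real (ks ! i) = of_int (n i)" if i: "i < m" for i
    proof -
      have "n i \<ge> 0"
      proof (cases "ev m (l i) p > 0")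
        case True
        then have "e i \<ge> 0" using lp[OF i] D by (auto simp: lex_pos_def e_def)
        then show ?thesis using True by (simp add: n_def)
      next
        case False
        then have "e i > 0" using lp[OF i] D by (auto simp: lex_pos_def e_def)
        then show ?thesis using False by (simp add: n_def)
      qed
      then show ?thesis using i by (simp add: ks_def)
    qed
    have ev_b: "ev m (l i) b = of_int D * (e i - of_int (n i))" if i: "i < m" for i
      using ks_n[OF i] unfolding b_def by (simp add: ev_diff ev_comb[OF i] ez algebra_simps)
    have b_lat: "b \<in> lattice m" unfolding b_def
      by (intro lattice_diff lattice_sum lattice_scale u_lattice) (use z in \<open>auto simp: points_def\<close>)
    have b_box: "b \<in> box p"
    proof -
      have "if ev m (l i) p > 0
        then 0 \<le> ev m (l i) b \<and> ev m (l i) b < of_int D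
        else 0 < ev m (l i) b \<and> ev m (l i) b \<le> of_int D" if i: "i < m" for i
      proof (cases "ev m (l i) p > 0")
        case True
        then have "0 \<le> e i - of_int (n i)" "e i - of_int (n i) < 1"
          unfolding n_def by simp_all linarith
        then have "0 \<le> of_int D * (e i - of_int (n i))" "of_int D * (e i - of_int (n i)) < of_int D * 1"
          using D by (intro mult_nonneg_nonneg mult_strict_left_mono; simp)+
        then show ?thesis using True ev_b[OF i] by simp
      next
        case False
        then have "0 < e i - of_int (n i)" "e i - of_int (n i) \<le> 1"
          unfolding n_def by simp_all linarith
        then have "0 < of_int D * (e i - of_int (n i))" "of_int D * (e i - of_int (n i)) \<le> of_int D * 1"
          using D by (intro mult_pos_pos mult_left_mono; simp)+
        then show ?thesis using False ev_b[OF i] by simp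
      qed
      then show ?thesis using b_lat by (simp add: box_def)
    qed
    have "ks \<in> decomp t b"
    proof -
      have "sum_list ks = (\<Sum>i<m. ks ! i)"
        by (simp add: ks_def sum_list_sum_nth lessThan_atLeast0)
      moreover have "real_of_int (ht b) = of_int t - of_int D * (\<Sum>i<m. real (ks ! i))"
        using z unfolding of_int_ht[OF b_lat] unfolding b_def
        by (simp add: sum_subtractf sum_comb points_def)
      ultimately have "real_of_int (D * int (sum_list ks)) = real_of_int (t - ht b)" by simp
      then show ?thesis by (simp only: of_int_eq_iff decomp_def) (simp add: ks_def)
    qed
    moreover have "assemble (b, ks) = z" by (auto simp: assemble_def b_def)
    ultimately show "z \<in> assemble ` (SIGMA b:box p. decomp t b)" using b_box by force
  qed
qed

text \<open>At \<open>t = 0\<close> a box point of height \<open>int m * D\<close> would spoil the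
  formula: it admits no composition, but its binomial coefficient is
  \<open>(-1) gchoose (m - 1)\<close>, which is not 0. A form \<open>l i\<close> positive at
  \<open>p\<close> excludes such a point.\<close>

lemma card_points_eq_count:
  assumes "t \<ge> 0" "t > 0 \<or> (\<exists>i<m. ev m (l i) p > 0)"
  shows "real (card (points m p (l ` {..<m}) t)) = count p t"
proof -
  have fin: "finite (decomp t b)" for b
  proof (rule finite_subset)
    show "decomp t b \<subseteq> {ks. length ks = m \<and> sum_list ks = nat ((t - ht b) div D)}"
      using D by (auto simp: decomp_def) (metis nat_int nonzero_mult_div_cancel_left less_irrefl)
    have "finite {ks. set ks \<subseteq> {..nat ((t - ht b) div D)} \<and> length ks = m}"
      by (rule finite_lists_length_eq) simp
    then show "finite {ks. length ks = m \<and> sum_list ks = nat ((t - ht b) div D)}"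
      by (rule rev_finite_subset) (use member_le_sum_list in fastforce)
  qed
  have "card (points m p (l ` {..<m}) t) = (\<Sum>b\<in>box p. card (decomp t b))"
    unfolding assemble_image[symmetric] by (simp add: card_image inj_assemble card_SigmaI finite_box fin)
  also have "real \<dots> = count p t" unfolding count_def of_nat_sum
  proof (rule sum.cong)
    fix b assume b: "b \<in> box p"
    have "t - ht b > - (int m * D)"
    proof (cases "t > 0")
      case True
      then show ?thesis using ht_box(1)[OF b] by linarith
    next
      case False
      then show ?thesis using ht_box(2)[OF b] assms by auto
    qed
    then show "real (card (decomp t b)) = (if D dvd t - ht b
     then (of_int (t - ht b) / of_int D + real (m - 1)) gchoose (m - 1) else 0)"
      unfolding decomp_def by (rule card_compositions[OF D m])
  qed simp
  finally show ?thesis .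
qed

text \<open>The reflection \<open>b \<mapsto> u\<^sub>0 + \<dots> + u\<^bsub>m-1\<^esub> - b\<close> exchanges the two half-open boxes.\<close>

lemma count_reflect:
  assumes nz: "\<And>i. i < m \<Longrightarrow> ev m (l i) p \<noteq> 0"
  shows "count (- p) (- t) = (-1) ^ (m - 1) * count p t"
proof -
  \<comment> \<open>The factor 1 gives the sum the shape of \<open>ev_comb\<close> and
    \<open>sum_comb\<close>.\<close>
  define \<rho> where "\<rho> b = (\<lambda>k. (\<Sum>i<m. 1 * u i k) - b k)" for b :: "nat \<Rightarrow> real"
  have lat: "\<rho> b \<in> lattice m" if "b \<in> lattice m" for b unfolding \<rho>_def
    by (intro lattice_diff lattice_sum lattice_scale u_lattice) (use that in auto)
  have ev: "ev m (l i) (\<rho> b) = of_int D - ev m (l i) b" if "i < m" for i b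
    using that unfolding \<rho>_def by (simp only: ev_diff ev_comb[OF that] mult_1_right)
  have box: "\<rho> b \<in> box (- p)" if "b \<in> box p" "\<And>i. i < m \<Longrightarrow> ev m (l i) p \<noteq> 0" for b p
  proof -
    have "if ev m (l i) (- p) > 0
      then 0 \<le> ev m (l i) (\<rho> b) \<and> ev m (l i) (\<rho> b) < of_int D
      else 0 < ev m (l i) (\<rho> b) \<and> ev m (l i) (\<rho> b) \<le> of_int D" if i: "i < m" for i
      using box_bounds[OF \<open>b \<in> box p\<close> i] \<open>\<And>i. i < m \<Longrightarrow> ev m (l i) p \<noteq> 0\<close>[OF i]
      by (auto simp: ev[OF i] ev_uminus)
    then show ?thesis using that(1) lat[of b] by (auto simp: box_def)
  qed
  have inv: "\<rho> (\<rho> b) = b" for b by (simp add: \<rho>_def)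
  have ht: "ht (\<rho> b) = int m * D - ht b" if "b \<in> lattice m" for b
  proof -
    have "real_of_int (ht (\<rho> b)) = of_int (int m * D - ht b)"
      unfolding of_int_ht[OF lat[OF that]] of_int_diff of_int_ht[OF that]
      unfolding \<rho>_def sum_subtractf sum_comb by simp
    then show ?thesis by (simp only: of_int_eq_iff)
  qed
  have "count (- p) (- t) = (\<Sum>b\<in>box p. (-1) ^ (m - 1) * (if D dvd t - ht b
     then (of_int (t - ht b) / of_int D + real (m - 1)) gchoose (m - 1) else 0))"
    unfolding count_def
  proof (rule sum.reindex_bij_witness[where i = \<rho> and j = \<rho>])
    fix b assume b: "b \<in> box (- p)"
    have "\<rho> b \<in> box (- (- p))" by (rule box[OF b]) (simp add: ev_uminus nz)
    moreover have "- (- p) = p" by (simp add: fun_eq_iff)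
    ultimately show "\<rho> b \<in> box p" by simp
    have b_lat: "b \<in> lattice m" using b by (simp add: box_def)
    have dvd: "D dvd t - ht (\<rho> b) \<longleftrightarrow> D dvd - t - ht b"
    proof -
      have "t - ht (\<rho> b) = - (- t - ht b) - D * int m" by (simp add: ht[OF b_lat])
      then show ?thesis by (metis dvd_diff_left_iff dvd_minus_iff dvd_triv_left)
    qed
    \<comment> \<open>In terms of \<open>x\<close> the reflected upper argument is
      \<open>- (x + 1)\<close>, and upper negation of the binomial coefficient produces both the
      sign and the original argument \<open>x + real (m - 1)\<close>.\<close>
    define x where "x = real_of_int (- t - ht b) / of_int D"
    have "real_of_int (t - ht (\<rho> b)) / of_int D = - x - real m"
      using D by (simp add: ht[OF b_lat] x_def field_simps)
    moreover have "(- x - real m + real (m - 1)) gchoose (m - 1) =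
        (-1) ^ (m - 1) * ((x + real (m - 1)) gchoose (m - 1))"
      using gbinomial_minus[of "x + 1" "m - 1"] m by (simp add: of_nat_diff algebra_simps)
    ultimately show "(-1) ^ (m - 1) * (if D dvd t - ht (\<rho> b)
       then (of_int (t - ht (\<rho> b)) / of_int D + real (m - 1)) gchoose (m - 1) else 0) =
      (if D dvd - t - ht b
       then (of_int (- t - ht b) / of_int D + real (m - 1)) gchoose (m - 1) else 0)"
      unfolding dvd x_def[symmetric] by (simp add: mult.assoc[symmetric] power_mult_distrib[symmetric])
  qed (auto simp: inv box nz)
  then show ?thesis by (simp add: count_def sum_distrib_left)
qed

lemma reciprocal_scaled:
  assumes "\<And>i. i < m \<Longrightarrow> ev m (l i) p \<noteq> 0" "(\<Sum>k<m. p k) > 0"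
  shows "reciprocal m p (l ` {..<m})"
  unfolding reciprocal_def
proof (intro exI[of _ "count (- p)"] conjI allI impI)
  show "quasipolynomial (count (- p))" by (rule quasipolynomial_count)
  show "count (- p) t = real (card (points m (- p) (l ` {..<m}) t))" if "t > 0" for t
    using that by (intro card_points_eq_count[symmetric]) auto
  \<comment> \<open>The dual forms add up to the coordinate sum, so one of them is positive at
    \<open>p\<close>; this admits \<open>t = 0\<close> in direction \<open>p\<close>.\<close>
  have "\<exists>i<m. ev m (l i) p > 0"
  proof (rule ccontr)
    assume "\<not> ?thesis"
    then have "(\<Sum>i<m. ev m (l i) p) \<le> 0" by (intro sum_nonpos) (meson lessThan_iff not_less)
    then show False using assms(2) by (simp flip: sum_eq_sum_ev)
  qed
  then show "real (card (points m p (l ` {..<m}) t)) = (-1) ^ (m - 1) * count (- p) (- t)"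
    if "t \<ge> 0" for t
    using that by (simp add: card_points_eq_count count_reflect[OF assms(1)]
        mult.assoc[symmetric] power_mult_distrib[symmetric])
qed

end

lemma Rats_common_denominator:
  assumes "finite A" "A \<subseteq> \<rat>"
  shows "\<exists>D::int. D > 0 \<and> (\<forall>x\<in>A. of_int D * (x::real) \<in> \<int>)"
  using assms
proof (induction A rule: finite_induct)
  case (insert x A)
  then obtain D :: int where D: "D > 0" "\<forall>x\<in>A. of_int D * x \<in> \<int>" by auto
  obtain a b :: int where b: "b > 0" "x = of_int a / of_int b"
    using insert.prems by (auto elim!: Rats_cases')
  have "of_int (D * b) * x = of_int (D * a)" using b by simp
  moreover have "of_int (D * b) * y \<in> \<int>" if "y \<in> A" for y
  proof -
    have "of_int (D * b) * y = of_int b * (of_int D * y)" by simp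
    then show ?thesis using D that by (metis Ints_mult Ints_of_int)
  qed
  ultimately show ?case using D b
    by (intro exI[of _ "D * b"]) (metis Ints_of_int insert_iff mult_pos_pos)
qed (auto intro: exI[of _ 1])

lemma (in simplicial_cone) reciprocal_simplicial_cone:
  assumes "\<And>i. i < m \<Longrightarrow> ev m (l i) p \<noteq> 0" "(\<Sum>k<m. p k) > 0"
  shows "reciprocal m p (l ` {..<m})"
proof -
  obtain D :: int where D: "D > 0" "\<forall>x\<in>(\<lambda>(i, k). v i k) ` ({..<m} \<times> {..<m}). of_int D * x \<in> \<int>"
    using Rats_common_denominator[of "(\<lambda>(i, k). v i k) ` ({..<m} \<times> {..<m})"] v_Rats by fastforce
  then interpret scaled_simplicial_cone m l v D by unfold_locales auto
  show ?thesis by (rule reciprocal_scaled) fact+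
qed

section \<open>Subdivision of cones\<close>

text \<open>Genericity is asked against all rational forms at once, because the hyperplanes
  introduced by the subdivisions are not known beforehand.\<close>

definition generic :: "nat \<Rightarrow> (nat \<Rightarrow> real) \<Rightarrow> bool" where
  "generic m p \<longleftrightarrow> (\<forall>c. (\<forall>k<m. c k \<in> \<rat>) \<and> (\<exists>k<m. c k \<noteq> 0) \<longrightarrow> ev m c p \<noteq> 0)"

lemma ev_nonzeroD: "ev m c x \<noteq> 0 \<Longrightarrow> \<exists>k<m. c k \<noteq> 0"
  unfolding ev_def by (rule ccontr) simp

lemma lex_pos_uminus_iff:
  assumes "ev m c p \<noteq> 0"
  shows "lex_pos m p (- c) x \<longleftrightarrow> \<not> lex_pos m p c x"
  using assms by (auto simp: lex_pos_def ev_uminus_left)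

text \<open>Either some term with positive coefficient is positive at \<open>x\<close>, or all those
  terms vanish at \<open>x\<close> and their forms are positive at \<open>p\<close>. So
  \<open>lex_pos\<close> behaves like positivity at an actual point.\<close>

lemma lex_pos_comb:
  assumes f: "\<And>x. ev m f x = (\<Sum>i\<in>I. a i * ev m (l i) x)"
    and I: "finite I" and nonneg: "\<And>i. i \<in> I \<Longrightarrow> a i \<ge> 0"
    and i0: "i0 \<in> I" "a i0 > 0"
    and pos: "\<And>i. i \<in> I \<Longrightarrow> lex_pos m p (l i) x"
  shows "lex_pos m p f x"
proof -
  have e: "ev m (l i) x \<ge> 0" if "i \<in> I" for i using pos[OF that] by (auto simp: lex_pos_def)
  show ?thesis
  proof (cases "\<exists>i\<in>I. a i > 0 \<and> ev m (l i) x > 0")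
    case True
    then obtain i where "i \<in> I" "a i * ev m (l i) x > 0" by auto
    then have "ev m f x > 0" unfolding f using I e nonneg by (intro sum_pos2) auto
    then show ?thesis by (simp add: lex_pos_def)
  next
    case False
    have z: "a i = 0 \<or> (a i > 0 \<and> ev m (l i) x = 0 \<and> ev m (l i) p > 0)" if "i \<in> I" for i
      using False pos[OF that] nonneg[OF that] that by (auto simp: lex_pos_def)
    then have "ev m f x = 0" unfolding f by (intro sum.neutral) auto
    moreover have "ev m f p > 0" unfolding f
    proof (rule sum_pos2[OF I i0(1)])
      show "a i0 * ev m (l i0) p > 0" using z[OF i0(1)] i0(2) by auto
      show "a i * ev m (l i) p \<ge> 0" if "i \<in> I" for i using z[OF that] by auto
    qed
    ultimately show ?thesis by (simp add: lex_pos_def)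
  qed
qed

lemma lex_pos_add:
  assumes "lex_pos m p c x" "lex_pos m p d x" "\<And>y. ev m f y = ev m c y + ev m d y"
  shows "lex_pos m p f x"
  using assms by (auto simp: lex_pos_def)

lemma lex_pos_scale:
  assumes "a > 0" "\<And>y. ev m f y = a * ev m c y"
  shows "lex_pos m p f x \<longleftrightarrow> lex_pos m p c x"
  using assms(1) by (simp add: lex_pos_def assms(2) zero_less_mult_iff)

lemma reciprocal_cong:
  assumes "\<And>q z. (\<forall>c\<in>F. lex_pos m q c z) \<longleftrightarrow> (\<forall>c\<in>G. lex_pos m q c z)"
  shows "reciprocal m p F \<longleftrightarrow> reciprocal m p G"
  unfolding reciprocal_def points_def assms ..

lemma reciprocal_empty:
  assumes "\<And>q z. \<not> (\<forall>c\<in>F. lex_pos m q c z)"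
  shows "reciprocal m p F"
proof -
  have "points m q F t = {}" for q t using assms by (auto simp: points_def)
  then show ?thesis unfolding reciprocal_def
    by (intro exI[of _ "\<lambda>_. 0"]) (auto simp: quasipolynomial_zero)
qed

text \<open>As \<open>g\<close> vanishes neither at \<open>p\<close> nor at \<open>- p\<close>, each
  direction assigns every point to exactly one side of the hyperplane. Counts and quasipolynomials
  then add up.\<close>

lemma reciprocal_split:
  assumes fin: "\<And>q t. finite (points m q F t)" and g: "ev m g p \<noteq> 0"
    and "reciprocal m p (insert g F)" "reciprocal m p (insert (- g) F)"
  shows "reciprocal m p F"
proof -
  have card: "card (points m q F t) = card (points m q (insert g F) t) + card (points m q (insert (- g) F) t)"
    if "ev m g q \<noteq> 0" for q t
  proof -
    have "points m q F t = points m q (insert g F) t \<union> points m q (insert (- g) F) t"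
      "points m q (insert g F) t \<inter> points m q (insert (- g) F) t = {}"
      using lex_pos_uminus_iff[OF that] by (auto simp: points_def)
    then show ?thesis using fin[of q t] by (metis card_Un_disjoint finite_Un)
  qed
  obtain q1 q2 where q: "quasipolynomial q1" "quasipolynomial q2"
    "\<And>t. t > 0 \<Longrightarrow> q1 t = real (card (points m (- p) (insert g F) t))"
    "\<And>t. t > 0 \<Longrightarrow> q2 t = real (card (points m (- p) (insert (- g) F) t))"
    "\<And>t. t \<ge> 0 \<Longrightarrow> real (card (points m p (insert g F) t)) = (-1) ^ (m - 1) * q1 (- t)"
    "\<And>t. t \<ge> 0 \<Longrightarrow> real (card (points m p (insert (- g) F) t)) = (-1) ^ (m - 1) * q2 (- t)"
    using assms(3,4) unfolding reciprocal_def by blast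
  have g': "ev m g (- p) \<noteq> 0" using g by (simp add: ev_uminus)
  show ?thesis unfolding reciprocal_def
    by (intro exI[of _ "\<lambda>t. q1 t + q2 t"])
       (auto simp: q card[OF g] card[OF g'] quasipolynomial_add algebra_simps)
qed

context simplicial_cone
begin

text \<open>
  The edge from \<open>v i\<close> to \<open>v j\<close> is subdivided at \<open>w = \<alpha> v i + \<beta> v j\<close>. The cone in which \<open>w\<close>
  replaces \<open>v i\<close> is the part of the given one where \<open>\<alpha> l j - \<beta> l i\<close> is positive.
\<close>

lemma subdivide:
  assumes ij: "i < m" "j < m" "i \<noteq> j" and \<alpha>: "\<alpha> > 0" "\<alpha> \<in> \<rat>" and \<beta>: "\<beta> > 0" "\<beta> \<in> \<rat>"
    and one: "\<alpha> + \<beta> = 1"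
    and l': "l' = l(i := (\<lambda>k. l i k / \<alpha>), j := (\<lambda>k. l j k - \<beta> / \<alpha> * l i k))"
    and v': "v' = v(i := (\<lambda>k. \<alpha> * v i k + \<beta> * v j k))"
    and g: "g = (\<lambda>k. \<alpha> * l j k - \<beta> * l i k)"
  shows "simplicial_cone m l' v'"
    and "(\<forall>c\<in>l' ` {..<m}. lex_pos m q c z) \<longleftrightarrow>
           lex_pos m q g z \<and> (\<forall>c\<in>l ` {..<m}. lex_pos m q c z)"
proof -
  have split: "(\<Sum>a<m. F a) = F i + F j + (\<Sum>a\<in>{..<m} - {i, j}. F a)" for F :: "nat \<Rightarrow> real"
  proof -
    have "{..<m} = insert i (insert j ({..<m} - {i, j}))" using ij by auto
    then have "(\<Sum>a<m. F a) = (\<Sum>a\<in>insert i (insert j ({..<m} - {i, j})). F a)" by simp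
    then show ?thesis using ij by simp
  qed
  have ev_l': "ev m (l' a) x = (if a = j then ev m (l j) x - \<beta> / \<alpha> * ev m (l i) x
      else if a = i then ev m (l i) x / \<alpha> else ev m (l a) x)" for a x
    unfolding l' using ij ev_scale_left[of m "1 / \<alpha>" "l i" x] ev_scale_left[of m "\<beta> / \<alpha>" "l i" x]
    by (simp add: ev_diff_left)
  show "simplicial_cone m l' v'"
  proof
    show "m \<ge> 1" by (rule m)
    show "l' a k \<in> \<rat>" "v' a k \<in> \<rat>" if "a < m" "k < m" for a k
      using that ij \<alpha> \<beta> l_Rats v_Rats unfolding l' v' by (auto intro!: Rats_diff Rats_divide Rats_mult Rats_add)
    show "ev m (l' a) (v' b) = (if a = b then 1 else 0)" if "a < m" "b < m" for a b
      using that ij \<alpha> unfolding ev_l' v' by (auto simp: ev_add ev_scale dual)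
    show "(\<Sum>k<m. l' k a * v' k b) = (if a = b then 1 else 0)" if ab: "a < m" "b < m" for a b
    proof -
      have "(\<Sum>k\<in>{..<m} - {i, j}. l' k a * v' k b) = (\<Sum>k\<in>{..<m} - {i, j}. l k a * v k b)"
        by (rule sum.cong) (auto simp: l' v')
      then have "(\<Sum>k<m. l' k a * v' k b) = (\<Sum>k<m. l k a * v k b)"
        unfolding split using ij \<alpha> by (simp add: l' v' field_simps)
      then show ?thesis using total[OF ab] by simp
    qed
    show "(\<Sum>k<m. l' k a) = 1" if a: "a < m" for a
    proof -
      have "(\<Sum>k\<in>{..<m} - {i, j}. l' k a) = (\<Sum>k\<in>{..<m} - {i, j}. l k a)"
        by (rule sum.cong) (auto simp: l')
      \<comment> \<open>This is where \<open>\<alpha> + \<beta> = 1\<close> enters: the new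
        generator again has coordinate sum 1.\<close>
      moreover have "l i a / \<alpha> - \<beta> / \<alpha> * l i a = l i a"
      proof -
        have "l i a / \<alpha> - \<beta> / \<alpha> * l i a = (1 - \<beta>) * l i a / \<alpha>"
          by (simp add: diff_divide_distrib algebra_simps)
        also have "1 - \<beta> = \<alpha>" using one by simp
        finally show ?thesis using \<alpha> by simp
      qed
      ultimately have "(\<Sum>k<m. l' k a) = (\<Sum>k<m. l k a)"
        unfolding split using ij by (simp add: l')
      then show ?thesis using height[OF a] by simp
    qed
  qed
  have g_l': "lex_pos m q g z \<longleftrightarrow> lex_pos m q (l' j) z"
    by (rule lex_pos_scale[of \<alpha>]) (use \<alpha> in \<open>simp_all add: ev_l' g ev_diff_left ev_scale_left algebra_simps\<close>)
  have i_l': "lex_pos m q (l i) z \<longleftrightarrow> lex_pos m q (l' i) z"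
    by (rule lex_pos_scale[of \<alpha>]) (use \<alpha> ij in \<open>simp_all add: ev_l'\<close>)
  have j_l': "lex_pos m q (l j) z" if "lex_pos m q (l' j) z" "lex_pos m q (l' i) z"
  proof (rule lex_pos_add[OF that(1)])
    show "lex_pos m q (\<lambda>k. \<beta> * l' i k) z"
      using lex_pos_scale[of \<beta> m "\<lambda>k. \<beta> * l' i k" "l' i"] \<beta>(1) that(2) by (simp add: ev_scale_left)
    show "ev m (l j) y = ev m (l' j) y + ev m (\<lambda>k. \<beta> * l' i k) y" for y
      using ij by (simp add: ev_l' ev_scale_left)
  qed
  have rest: "l' a = l a" if "a \<noteq> i" "a \<noteq> j" for a using that by (simp add: l')
  show "(\<forall>c\<in>l' ` {..<m}. lex_pos m q c z) \<longleftrightarrow>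
      lex_pos m q g z \<and> (\<forall>c\<in>l ` {..<m}. lex_pos m q c z)"
  proof
    assume L: "\<forall>c\<in>l' ` {..<m}. lex_pos m q c z"
    have "lex_pos m q (l a) z" if a: "a < m" for a
    proof -
      have "lex_pos m q (l' i) z" "lex_pos m q (l' j) z" "lex_pos m q (l' a) z"
        using L ij a by auto
      then show ?thesis using i_l' j_l' rest[of a] by metis
    qed
    moreover have "lex_pos m q g z" using L ij g_l' by blast
    ultimately show "lex_pos m q g z \<and> (\<forall>c\<in>l ` {..<m}. lex_pos m q c z)" by blast
  next
    assume R: "lex_pos m q g z \<and> (\<forall>c\<in>l ` {..<m}. lex_pos m q c z)"
    have "lex_pos m q (l' a) z" if a: "a < m" for a
      using R a ij g_l' i_l' rest[of a] by (metis imageI lessThan_iff)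
    then show "\<forall>c\<in>l' ` {..<m}. lex_pos m q c z" by blast
  qed
qed

end

lemma rational_ev: "(\<forall>k<m. c k \<in> \<rat>) \<Longrightarrow> (\<forall>k<m. x k \<in> \<rat>) \<Longrightarrow> ev m c x \<in> \<rat>"
  unfolding ev_def by (rule Rats_sum) auto

text \<open>The extra forms are removed one at a time. A form that is nonnegative on all generators
  follows from the cone, a nonpositive one contradicts it. Otherwise an edge between generators of
  opposite sign is cut at the zero of the form; in both halves fewer generators lie off its
  hyperplane.\<close>

lemma reciprocal_cone:
  assumes "simplicial_cone m l v" "generic m p" "(\<Sum>k<m. p k) > 0"
    and "\<And>f. f \<in> set L \<Longrightarrow> (\<forall>k<m. f k \<in> \<rat>) \<and> (\<exists>k<m. f k \<noteq> 0)"
  shows "reciprocal m p (l ` {..<m} \<union> set L)"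
  using assms(1,4)
proof (induction L arbitrary: l v)
  case Nil
  then interpret simplicial_cone m l v by simp
  have "ev m (l i) p \<noteq> 0" if "i < m" for i
  proof -
    have "\<exists>k<m. l i k \<noteq> 0" using dual[OF that that] by (intro ev_nonzeroD[of _ _ "v i"]) simp
    then show ?thesis using assms(2) that l_Rats unfolding generic_def by blast
  qed
  then show ?case using reciprocal_simplicial_cone assms(3) by simp
next
  case (Cons f L)
  have f: "\<forall>k<m. f k \<in> \<rat>" "ev m f p \<noteq> 0"
    using Cons.prems(2)[of f] assms(2) unfolding generic_def by auto
  have L: "\<And>f. f \<in> set L \<Longrightarrow> (\<forall>k<m. f k \<in> \<rat>) \<and> (\<exists>k<m. f k \<noteq> 0)"
    using Cons.prems(2) by simp
  have "simplicial_cone m l v \<Longrightarrow> reciprocal m p (l ` {..<m} \<union> set (f # L))" for l v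
  proof (induction "card {i\<in>{..<m}. ev m f (v i) \<noteq> 0}" arbitrary: l v rule: less_induct)
    case less
    then interpret simplicial_cone m l v by simp
    \<comment> \<open>A form vanishing on all generators would vanish at \<open>p\<close>, against
      genericity.\<close>
    have nz: "\<exists>i<m. ev m f (v i) \<noteq> 0"
    proof (rule ccontr)
      assume "\<not> ?thesis"
      then have "(\<Sum>i<m. ev m f (v i) * ev m (l i) p) = 0" by simp
      then show False using f(2) ev_expand[of f p] by simp
    qed
    consider (nonneg) "\<forall>i<m. ev m f (v i) \<ge> 0" | (nonpos) "\<forall>i<m. ev m f (v i) \<le> 0"
      | (mixed) i j where "i < m" "ev m f (v i) > 0" "j < m" "ev m f (v j) < 0"
      by (meson not_less)
    then show ?case
    proof cases
      case nonneg
      have "reciprocal m p (l ` {..<m} \<union> set (f # L)) \<longleftrightarrow> reciprocal m p (l ` {..<m} \<union> set L)"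
      proof (rule reciprocal_cong)
        fix q z
        obtain i0 where "i0 < m" "ev m f (v i0) > 0" using nz nonneg by (metis order_le_less)
        then have "lex_pos m q f z" if "\<forall>c\<in>l ` {..<m}. lex_pos m q c z"
          by (intro lex_pos_comb[where f = f and ?i0.0 = i0, OF ev_expand]) (use nonneg that in auto)
        then show "(\<forall>c\<in>l ` {..<m} \<union> set (f # L). lex_pos m q c z) \<longleftrightarrow>
            (\<forall>c\<in>l ` {..<m} \<union> set L. lex_pos m q c z)" by auto
      qed
      then show ?thesis using Cons.IH[OF less.prems L] by simp
    next
      case nonpos
      show ?thesis
      proof (rule reciprocal_empty, rule notI)
        fix q z assume pos: "\<forall>c\<in>l ` {..<m} \<union> set (f # L). lex_pos m q c z"
        obtain i0 where i0: "i0 < m" "ev m f (v i0) < 0" using nz nonpos by (metis order_le_less)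
        have "ev m (- f) x = (\<Sum>i<m. - ev m f (v i) * ev m (l i) x)" for x
          unfolding ev_uminus_left ev_expand[of f x] by (simp add: sum_negf)
        then have "lex_pos m q (- f) z"
          by (rule lex_pos_comb[where ?i0.0 = i0]) (use i0 nonpos pos in auto)
        moreover have "lex_pos m q f z" using pos by simp
        ultimately show False by (auto simp: lex_pos_def ev_uminus_left)
      qed
    next
      case mixed
      \<comment> \<open>The weights of the point on the edge from \<open>v i\<close> to
        \<open>v j\<close> at which \<open>f\<close> vanishes.\<close>
      define \<alpha> where "\<alpha> = - ev m f (v j) / (ev m f (v i) - ev m f (v j))"
      define \<beta> where "\<beta> = ev m f (v i) / (ev m f (v i) - ev m f (v j))"
      have ij: "i \<noteq> j" using mixed by auto
      have "ev m f (v k) \<in> \<rat>" if "k < m" for k using f(1) v_Rats that by (intro rational_ev) auto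
      then have \<alpha>: "\<alpha> > 0" "\<alpha> \<in> \<rat>" and \<beta>: "\<beta> > 0" "\<beta> \<in> \<rat>" unfolding \<alpha>_def \<beta>_def
        using mixed by (auto intro!: divide_pos_pos divide_neg_pos Rats_divide Rats_diff simp: Rats_minus_iff)
      have one: "\<alpha> + \<beta> = 1" unfolding \<alpha>_def \<beta>_def add_divide_distrib[symmetric] using mixed by simp
      have w: "\<alpha> * ev m f (v i) + \<beta> * ev m f (v j) = 0" unfolding \<alpha>_def \<beta>_def by (simp add: field_simps)
      define g where "g = (\<lambda>k. \<alpha> * l j k - \<beta> * l i k)"
      define l1 where "l1 = l(i := (\<lambda>k. l i k / \<alpha>), j := (\<lambda>k. l j k - \<beta> / \<alpha> * l i k))"
      define v1 where "v1 = v(i := (\<lambda>k. \<alpha> * v i k + \<beta> * v j k))"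
      \<comment> \<open>The other half arises by exchanging \<open>i\<close> with \<open>j\<close>
        and \<open>\<alpha>\<close> with \<open>\<beta>\<close>, which turns the separating form
        \<open>g\<close> into \<open>- g\<close>.\<close>
      define l2 where "l2 = l(j := (\<lambda>k. l j k / \<beta>), i := (\<lambda>k. l i k - \<alpha> / \<beta> * l j k))"
      define v2 where "v2 = v(j := (\<lambda>k. \<beta> * v j k + \<alpha> * v i k))"
      have minus_g: "- g = (\<lambda>k. \<beta> * l i k - \<alpha> * l j k)" by (simp add: g_def fun_eq_iff)
      note s1 = subdivide[OF mixed(1,3) ij \<alpha> \<beta> one l1_def v1_def g_def]
      have "\<beta> + \<alpha> = 1" using one by simp
      note s2 = subdivide[OF mixed(3,1) ij[symmetric] \<beta> \<alpha> this l2_def v2_def minus_g]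
      have "ev m f (v1 k) = (if k = i then 0 else ev m f (v k))" for k
        using w by (simp add: v1_def ev_add ev_scale)
      then have "card {k\<in>{..<m}. ev m f (v1 k) \<noteq> 0} < card {k\<in>{..<m}. ev m f (v k) \<noteq> 0}"
        using mixed by (intro psubset_card_mono) (auto split: if_splits)
      then have r1: "reciprocal m p (l1 ` {..<m} \<union> set (f # L))" using s1(1) by (rule less.hyps)
      have "ev m f (v2 k) = (if k = j then 0 else ev m f (v k))" for k
        using w by (simp add: v2_def ev_add ev_scale)
      then have "card {k\<in>{..<m}. ev m f (v2 k) \<noteq> 0} < card {k\<in>{..<m}. ev m f (v k) \<noteq> 0}"
        using mixed by (intro psubset_card_mono) (auto split: if_splits)
      then have r2: "reciprocal m p (l2 ` {..<m} \<union> set (f # L))" using s2(1) by (rule less.hyps)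
      show ?thesis
      proof (rule reciprocal_split)
        show "finite (points m q (l ` {..<m} \<union> set (f # L)) t)" for q t by (rule finite_points) blast
        have "ev m g (v j) \<noteq> 0" using mixed ij \<alpha> by (simp add: g_def ev_diff_left ev_scale_left dual)
        then have "\<exists>k<m. g k \<noteq> 0" by (rule ev_nonzeroD)
        moreover have "\<forall>k<m. g k \<in> \<rat>" using \<alpha> \<beta> l_Rats mixed by (auto simp: g_def)
        ultimately show "ev m g p \<noteq> 0" using assms(2) unfolding generic_def by blast
        have "reciprocal m p (insert g (l ` {..<m} \<union> set (f # L))) \<longleftrightarrow>
            reciprocal m p (l1 ` {..<m} \<union> set (f # L))"
          by (rule reciprocal_cong) (simp only: ball_Un ball_simps(7) s1(2) conj_assoc)
        then show "reciprocal m p (insert g (l ` {..<m} \<union> set (f # L)))" using r1 by simp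
        have "reciprocal m p (insert (- g) (l ` {..<m} \<union> set (f # L))) \<longleftrightarrow>
            reciprocal m p (l2 ` {..<m} \<union> set (f # L))"
          by (rule reciprocal_cong) (simp only: ball_Un ball_simps(7) s2(2) conj_assoc)
        then show "reciprocal m p (insert (- g) (l ` {..<m} \<union> set (f # L)))" using r2 by simp
      qed
    qed
  qed
  then show ?case using Cons.prems(1) .
qed

section \<open>Chambers\<close>

text \<open>
  The coordinates of \<open>p\<close> are chosen one after the other, each outside the countable rational
  span of the previous ones.
\<close>

lemma exists_generic_near:
  assumes "\<delta> > 0"
  shows "\<exists>p. generic m p \<and> (\<forall>k<m. \<bar>p k - y k\<bar> < \<delta>)"
proof (induction m)
  case 0
  then show ?case by (auto simp: generic_def)
next
  case (Suc m)
  then obtain p where p: "generic m p" "\<And>k. k < m \<Longrightarrow> \<bar>p k - y k\<bar> < \<delta>" by blast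
  define A where "A = (\<lambda>c. ev m c p) ` (PiE {..<m} (\<lambda>_. \<rat>))"
  have "countable A" unfolding A_def by (intro countable_image countable_PiE) (auto simp: countable_rat)
  moreover have "uncountable {y m - \<delta><..<y m + \<delta>}" using assms by (intro uncountable_open_interval[THEN iffD2]) simp
  ultimately obtain x where x: "x \<in> {y m - \<delta><..<y m + \<delta>}" "x \<notin> A"
    by (meson countable_subset subsetI)
  define p' where "p' = p(m := x)"
  have ev': "ev (Suc m) c p' = ev m c p + c m * x" for c
    by (simp add: ev_def p'_def)
  have "ev (Suc m) c p' \<noteq> 0" if c: "\<forall>k<Suc m. c k \<in> \<rat>" "\<exists>k<Suc m. c k \<noteq> 0" for c
  proof (cases "c m = 0")
    case True
    then have "\<exists>k<m. c k \<noteq> 0" using c(2) less_Suc_eq by auto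
    then show ?thesis using p(1) c(1) True by (auto simp: ev' generic_def)
  next
    case False
    \<comment> \<open>If \<open>c\<close> vanished at \<open>p'\<close>, then \<open>x\<close> would
      be the value at \<open>p\<close> of this rational form.\<close>
    define d where "d = restrict (\<lambda>k. - c k / c m) {..<m}"
    have "d \<in> PiE {..<m} (\<lambda>_. \<rat>)" using c(1) by (auto simp: d_def intro!: Rats_divide)
    moreover have "ev m d p = - ev m c p / c m"
      by (simp add: ev_def d_def sum_divide_distrib sum_negf)
    ultimately have "x \<noteq> - ev m c p / c m" using x(2) unfolding A_def by (metis imageI)
    then show ?thesis using False by (auto simp: ev' field_simps eq_neg_iff_add_eq_0)
  qed
  then have "generic (Suc m) p'" by (auto simp: generic_def)
  moreover have "\<bar>p' k - y k\<bar> < \<delta>" if "k < Suc m" for k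
    using that p(2) x(1) by (auto simp: p'_def less_Suc_eq abs_less_iff)
  ultimately show ?case by blast
qed

lemma ev_pos_open:
  assumes "finite F" "\<And>c. c \<in> F \<Longrightarrow> ev m c y > 0"
  shows "\<exists>\<delta>>0. \<forall>p. (\<forall>k<m. \<bar>p k - y k\<bar> < \<delta>) \<longrightarrow> (\<forall>c\<in>F. ev m c p > 0)"
  using assms
proof (induction F rule: finite_induct)
  case empty
  then show ?case by (auto intro: exI[of _ 1])
next
  case (insert c F)
  then obtain \<delta> where \<delta>: "\<delta> > 0" "\<And>p. (\<forall>k<m. \<bar>p k - y k\<bar> < \<delta>) \<Longrightarrow> \<forall>c\<in>F. ev m c p > 0" by auto
  \<comment> \<open>\<open>B - 1\<close> is a Lipschitz constant of the form in the maximum norm;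
    the added 1 makes \<open>B\<close> positive and the final estimate strict.\<close>
  define B where "B = 1 + (\<Sum>k<m. \<bar>c k\<bar>)"
  define \<delta>' where "\<delta>' = ev m c y / B"
  have B: "B > 0" unfolding B_def by (intro add_pos_nonneg sum_nonneg) auto
  have \<delta>': "\<delta>' > 0" using insert.prems B by (simp add: \<delta>'_def)
  have "ev m c p > 0" if close: "\<forall>k<m. \<bar>p k - y k\<bar> < \<delta>'" for p
  proof -
    have "\<bar>ev m c p - ev m c y\<bar> \<le> (\<Sum>k<m. \<bar>c k\<bar> * \<bar>p k - y k\<bar>)"
      unfolding ev_diff[symmetric] unfolding ev_def
      by (rule order.trans[OF sum_abs]) (simp add: abs_mult)
    also have "\<dots> \<le> (\<Sum>k<m. \<bar>c k\<bar> * \<delta>')"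
      using close by (intro sum_mono mult_left_mono) (auto intro: less_imp_le)
    also have "\<dots> = (B - 1) * \<delta>'" by (simp add: B_def sum_distrib_right)
    also have "\<dots> < B * \<delta>'" using \<delta>' by (simp add: algebra_simps)
    also have "\<dots> = ev m c y" using B by (simp add: \<delta>'_def)
    finally show ?thesis by linarith
  qed
  then show ?case using \<delta> \<delta>'
    by (intro exI[of _ "min \<delta> \<delta>'"]) auto
qed

lemma exists_generic_pos:
  assumes "finite F" "\<And>c. c \<in> F \<Longrightarrow> ev m c y > 0"
  shows "\<exists>p. generic m p \<and> (\<forall>c\<in>F. ev m c p > 0)"
  proof -
  obtain \<delta> where \<delta>: "\<delta> > 0" "\<And>p. (\<forall>k<m. \<bar>p k - y k\<bar> < \<delta>) \<Longrightarrow> \<forall>c\<in>F. ev m c p > 0"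
    using ev_pos_open[OF assms] by blast
  then show ?thesis using exists_generic_near[OF \<delta>(1), of m y] by blast
qed

text \<open>A rational point close to \<open>y\<close> satisfies the same strict inequalities, and
  clearing its denominators preserves them since the forms are homogeneous.\<close>

lemma exists_lattice_pos:
  assumes "finite F" "\<And>c. c \<in> F \<Longrightarrow> ev m c y > 0"
  shows "\<exists>z\<in>lattice m. \<forall>c\<in>F. ev m c z > 0"
proof -
  obtain \<delta> where \<delta>: "\<delta> > 0" "\<And>p. (\<forall>k<m. \<bar>p k - y k\<bar> < \<delta>) \<Longrightarrow> \<forall>c\<in>F. ev m c p > 0"
    using ev_pos_open[OF assms] by blast
  have "\<exists>r\<in>\<rat>. \<bar>r - y k\<bar> < \<delta>" for k
  proof -
    obtain r where "r \<in> \<rat>" "y k < r" "r < y k + \<delta>"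
      using Rats_dense_in_real[of "y k" "y k + \<delta>"] \<delta>(1) by auto
    then show ?thesis by (intro bexI[of _ r]) auto
  qed
  then obtain p where p: "\<And>k. p k \<in> \<rat>" "\<And>k. \<bar>p k - y k\<bar> < \<delta>" by metis
  obtain D :: int where D: "D > 0" "\<forall>x\<in>p ` {..<m}. of_int D * x \<in> \<int>"
    using Rats_common_denominator[of "p ` {..<m}"] p(1) by blast
  define z where "z k = (if k < m then of_int D * p k else 0)" for k
  have "z \<in> lattice m" using D(2) by (auto simp: z_def lattice_def)
  moreover have "ev m c z > 0" if "c \<in> F" for c
  proof -
    have "ev m c z = ev m c (\<lambda>k. of_int D * p k)" by (rule ev_cong) (auto simp: z_def)
    then show ?thesis using \<delta>(2)[of p] p(2) that D(1) by (simp add: ev_scale)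
  qed
  ultimately show ?thesis by blast
qed

section \<open>The positive orthant and reciprocity for a single chamber\<close>

definition unit_form :: "nat \<Rightarrow> nat \<Rightarrow> real" where
  "unit_form i k = (if i = k then 1 else 0)"

lemma ev_unit_form: "i < m \<Longrightarrow> ev m (unit_form i) x = x i"
proof -
  assume "i < m"
  have "ev m (unit_form i) x = (\<Sum>k<m. if k = i then x k else 0)"
    unfolding ev_def unit_form_def by (rule sum.cong) auto
  then show ?thesis using \<open>i < m\<close> by simp
qed

text \<open>The standard basis is its own dual. The orthant it spans is the cone from which the
  subdivision starts.\<close>

lemma simplicial_cone_unit: "m \<ge> 1 \<Longrightarrow> simplicial_cone m unit_form unit_form"
proof
  assume "m \<ge> 1"
  then show "1 \<le> m" .
  fix i k assume "i < m" "k < m"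
  show "ev m (unit_form i) (unit_form k) = (if i = k then 1 else 0)"
    using \<open>i < m\<close> by (auto simp: ev_unit_form unit_form_def)
  show "(\<Sum>j<m. unit_form j i * unit_form j k) = (if i = k then 1 else 0)"
  proof -
    have "(\<Sum>j<m. unit_form j i * unit_form j k) = (\<Sum>j<m. if j = k then unit_form k i else 0)"
      by (rule sum.cong) (auto simp: unit_form_def)
    then show ?thesis using \<open>k < m\<close> by (simp add: unit_form_def)
  qed
next
  show "(\<Sum>i<m. unit_form i k) = 1" if "k < m" for k
    using that by (simp add: unit_form_def)
qed (auto simp: unit_form_def)

text \<open>The point \<open>y\<close> shows that the open chamber is nonempty, and a generic
  \<open>p\<close> is chosen inside it. The unit forms make all coordinates of \<open>p\<close>
  positive, which gives the positive coordinate sum asked for by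
  \<open>reciprocal_cone\<close>.\<close>

lemma chamber_reciprocity:
  assumes m: "m \<ge> 1" and G: "finite G" "\<And>f. f \<in> G \<Longrightarrow> (\<forall>k<m. f k \<in> \<rat>) \<and> (\<exists>k<m. f k \<noteq> 0)"
    and F: "F = unit_form ` {..<m} \<union> G" and y: "\<And>c. c \<in> F \<Longrightarrow> ev m c y > 0"
  shows "\<exists>q. quasipolynomial q \<and>
    (\<forall>t>0. q t = real (card {z \<in> lattice m. (\<forall>c\<in>F. ev m c z > 0) \<and> (\<Sum>k<m. z k) = of_int t})) \<and>
    (\<forall>t\<ge>0. real (card {z \<in> lattice m. (\<forall>c\<in>F. ev m c z \<ge> 0) \<and> (\<Sum>k<m. z k) = of_int t}) =
      (-1) ^ (m - 1) * q (- t))"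
proof -
  have "finite F" using F G by simp
  then obtain p where p: "generic m p" "\<forall>c\<in>F. ev m c p > 0" using exists_generic_pos y by blast
  have "p k > 0" if "k < m" for k
  proof -
    have "ev m (unit_form k) p > 0" using p(2) that F by blast
    then show ?thesis using ev_unit_form[OF that] by simp
  qed
  then have sum: "(\<Sum>k<m. p k) > 0" using m by (intro sum_pos) (auto simp: lessThan_empty_iff)
  obtain L where L: "set L = G" using G(1) finite_list by blast
  have rec: "reciprocal m p F"
    using reciprocal_cone[OF simplicial_cone_unit[OF m] p(1) sum, of L] G(2) L F by simp
  have "points m p F t = {z \<in> lattice m. (\<forall>c\<in>F. ev m c z \<ge> 0) \<and> (\<Sum>k<m. z k) = of_int t}" for t
    using p(2) by (fastforce simp: points_def lex_pos_def)
  moreover have "points m (- p) F t = {z \<in> lattice m. (\<forall>c\<in>F. ev m c z > 0) \<and> (\<Sum>k<m. z k) = of_int t}" for t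
    using p(2) by (fastforce simp: points_def lex_pos_def ev_uminus)
  ultimately show ?thesis using rec unfolding reciprocal_def by simp
qed

section \<open>Order types and multiplicities\<close>

text \<open>A complete invariant of the combinatorial type, with values in a finite set. It also
  applies directly to integral rulers.\<close>

definition order_type :: "nat \<Rightarrow> nat \<Rightarrow> 'a::linordered_idom list \<Rightarrow> (nat list \<times> nat list) set" where
  "order_type m h x = {(r, s). r \<in> index_seqs m h \<and> s \<in> index_seqs m h \<and> mark_sum x r < mark_sum x s}"

definition order_types :: "nat \<Rightarrow> nat \<Rightarrow> (nat list \<times> nat list) set set" where
  "order_types m h = order_type m h ` {x :: real list. \<exists>t. Bh_set m h t x}"

text \<open>For a weak ruler this is membership in the closed chamber of \<open>S\<close>.\<close>

definition weakly_ordered :: "(nat list \<times> nat list) set \<Rightarrow> 'a::linordered_idom list \<Rightarrow> bool" where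
  "weakly_ordered S x \<longleftrightarrow> (\<forall>(r, s)\<in>S. mark_sum x r \<le> mark_sum x s)"

lemma finite_index_seqs: "finite (index_seqs m h)"
  by (rule finite_subset[OF _ finite_lists_length_eq[of "{0..m}" h]]) (auto simp: index_seqs_def)

lemma finite_order_types: "finite (order_types m h)"
proof (rule finite_subset)
  show "order_types m h \<subseteq> Pow (index_seqs m h \<times> index_seqs m h)"
    by (auto simp: order_types_def order_type_def)
qed (simp add: finite_index_seqs)

text \<open>In a B_h-set distinct index sequences never tie, so the failure of \<open><\<close>
  means \<open>>\<close>, and the strict inequalities determine everything.\<close>

lemma comb_equiv_iff:
  "(x, y) \<in> comb_equiv m h \<longleftrightarrow>
    (\<exists>t. Bh_set m h t x) \<and> (\<exists>t. Bh_set m h t y) \<and> order_type m h x = order_type m h y"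
proof -
  define P where "P \<longleftrightarrow> (\<forall>r\<in>index_seqs m h. \<forall>s\<in>index_seqs m h. r \<noteq> s \<longrightarrow>
        mark_sum x r < mark_sum x s \<and> mark_sum y r < mark_sum y s \<or>
        mark_sum x r > mark_sum x s \<and> mark_sum y r > mark_sum y s)"
  have "P \<longleftrightarrow> order_type m h x = order_type m h y"
    if "Bh_set m h t x" "Bh_set m h t' y" for t t'
    unfolding P_def
  proof
    assume *: "\<forall>r\<in>index_seqs m h. \<forall>s\<in>index_seqs m h. r \<noteq> s \<longrightarrow>
        mark_sum x r < mark_sum x s \<and> mark_sum y r < mark_sum y s \<or>
        mark_sum x r > mark_sum x s \<and> mark_sum y r > mark_sum y s"
    have "mark_sum x r < mark_sum x s \<longleftrightarrow> mark_sum y r < mark_sum y s"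
      if "r \<in> index_seqs m h" "s \<in> index_seqs m h" for r s
      using *[rule_format, OF that] by (cases "r = s") auto
    then show "order_type m h x = order_type m h y" by (auto simp: order_type_def)
  next
    assume *: "order_type m h x = order_type m h y"
    have **: "mark_sum x r < mark_sum x s \<longleftrightarrow> mark_sum y r < mark_sum y s"
      if "r \<in> index_seqs m h" "s \<in> index_seqs m h" for r s
      using that * by (auto simp: order_type_def set_eq_iff)
    show "\<forall>r\<in>index_seqs m h. \<forall>s\<in>index_seqs m h. r \<noteq> s \<longrightarrow>
        mark_sum x r < mark_sum x s \<and> mark_sum y r < mark_sum y s \<or>
        mark_sum x r > mark_sum x s \<and> mark_sum y r > mark_sum y s"
    proof (intro ballI impI)
      fix r s assume "r \<in> index_seqs m h" "s \<in> index_seqs m h" "r \<noteq> s"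
      moreover from this have "mark_sum x r \<noteq> mark_sum x s"
        using \<open>Bh_set m h t x\<close> by (simp add: Bh_set_def)
      ultimately show "mark_sum x r < mark_sum x s \<and> mark_sum y r < mark_sum y s \<or>
        mark_sum x r > mark_sum x s \<and> mark_sum y r > mark_sum y s"
        using **[of r s] **[of s r] by auto
    qed
  qed
  moreover have "(x, y) \<in> comb_equiv m h \<longleftrightarrow> (\<exists>t. Bh_set m h t x) \<and> (\<exists>t. Bh_set m h t y) \<and> P"
    by (simp only: comb_equiv_def P_def mem_Collect_eq prod.case)
  ultimately show ?thesis by blast
qed

text \<open>\<open>cl\<close> sends an order type to its full equivalence class, and any member of
  the class gives the order type back.\<close>

lemma card_comb_types:
  assumes "\<And>x. x \<in> A \<Longrightarrow> \<exists>t. Bh_set m h t x"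
  shows "card (comb_types m h A) = card (order_type m h ` A)"
proof -
  define cl where "cl S = {y :: real list. (\<exists>t. Bh_set m h t y) \<and> order_type m h y = S}" for S
  have "comb_types m h A = cl ` order_type m h ` A"
  proof -
    have "comb_equiv m h `` {x} = cl (order_type m h x)" if "x \<in> A" for x
      using assms[OF that] by (auto simp: comb_equiv_iff cl_def)
    then show ?thesis by (auto simp: comb_types_def quotient_def)
  qed
  moreover have "inj_on cl (order_type m h ` A)"
  proof (rule inj_onI, clarify)
    fix x y :: "real list" assume x: "x \<in> A" and eq: "cl (order_type m h x) = cl (order_type m h y)"
    have "x \<in> cl (order_type m h x)" using assms[OF x] by (simp add: cl_def)
    then have "x \<in> cl (order_type m h y)" unfolding eq .
    then show "order_type m h x = order_type m h y" by (simp add: cl_def)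
  qed
  ultimately show ?thesis by (simp add: card_image)
qed

section \<open>Integral rulers and their real images\<close>

lemma mark_sum_of_int:
  assumes "length x = m + 1" "set r \<subseteq> {0..m}"
  shows "mark_sum (map real_of_int x) r = of_int (mark_sum x r)"
  using assms(2) by (induction r) (auto simp: mark_sum_def assms(1))

lemma order_type_of_int:
  "length x = m + 1 \<Longrightarrow> order_type m h (map real_of_int x) = order_type m h x"
  by (auto simp: order_type_def index_seqs_def mark_sum_of_int)

lemma ruler_of_int: "ruler m (of_int t) (map real_of_int x) \<longleftrightarrow> ruler m t x"
  by (cases "length x = m + 1") (auto simp: ruler_def sorted_wrt_map)

lemma Bh_set_of_int: "Bh_set m h (of_int t) (map real_of_int x) \<longleftrightarrow> Bh_set m h t x"
proof (cases "length x = m + 1")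
  case True
  then show ?thesis
    unfolding Bh_set_def ruler_of_int by (auto simp: index_seqs_def mark_sum_of_int)
qed (simp add: Bh_set_def ruler_def)

section \<open>Types of B_h-sets close to an integral ruler\<close>

lemma abs_mark_sum_diff_le:
  fixes x y :: "real list"
  assumes "\<And>i. i \<in> {0..m} \<Longrightarrow> \<bar>y ! i - x ! i\<bar> \<le> \<epsilon>" "set r \<subseteq> {0..m}"
  shows "\<bar>mark_sum y r - mark_sum x r\<bar> \<le> real (length r) * \<epsilon>"
  using assms(2)
proof (induction r)
  case (Cons a r)
  then have "\<bar>mark_sum y r - mark_sum x r\<bar> \<le> real (length r) * \<epsilon>" "\<bar>y ! a - x ! a\<bar> \<le> \<epsilon>"
    using assms(1) by auto
  then show ?case by (simp add: mark_sum_def algebra_simps)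
qed (simp add: mark_sum_def)

text \<open>Unequal sums of an integral ruler differ by at least 1, while moving the markings by at
  most \<open>\<epsilon>\<close> changes the difference of two sums by at most
  \<open>2 * h * \<epsilon>\<close>. So no strict inequality of \<open>x\<close> is reversed
  nearby.\<close>

lemma order_types_near_subset:
  assumes x: "length x = m + 1" and \<epsilon>: "0 < \<epsilon>" "\<epsilon> * (2 * real h) < 1"
  shows "order_type m h ` Bh_sets_near m h t x \<epsilon> \<subseteq> {S \<in> order_types m h. weakly_ordered S x}"
proof clarify
  fix y assume y: "y \<in> Bh_sets_near m h t x \<epsilon>"
  have close: "\<bar>y ! i - map real_of_int x ! i\<bar> \<le> \<epsilon>" if i: "i \<in> {0..m}" for i
  proof -
    have "\<bar>y ! i - real_of_int (x ! i)\<bar> \<le> L2_set (\<lambda>i. y ! i - real_of_int (x ! i)) {0..m}"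
      using member_le_L2_set[of "{0..m}" i "\<lambda>i. \<bar>y ! i - real_of_int (x ! i)\<bar>"] i
      by (simp add: L2_set_def)
    then show ?thesis using y i x by (simp add: Bh_sets_near_def)
  qed
  have "mark_sum x r \<le> mark_sum x s" if rs: "(r, s) \<in> order_type m h y" for r s
  proof (rule ccontr)
    assume "\<not> ?thesis"
    then have "mark_sum x s + 1 \<le> mark_sum x r" by simp
    then have "real_of_int (mark_sum x s) + 1 \<le> of_int (mark_sum x r)" by linarith
    moreover have r: "set r \<subseteq> {0..m}" "set s \<subseteq> {0..m}" "length r = h" "length s = h" "mark_sum y r < mark_sum y s"
      using rs by (auto simp: order_type_def index_seqs_def)
    ultimately show False
      using abs_mark_sum_diff_le[OF close r(1)] abs_mark_sum_diff_le[OF close r(2)] \<epsilon>(2)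
      by (simp add: mark_sum_of_int[OF x] algebra_simps)
  qed
  then have "weakly_ordered (order_type m h y) x" by (auto simp: weakly_ordered_def)
  moreover have "order_type m h y \<in> order_types m h"
    using y by (auto simp: order_types_def Bh_sets_near_def)
  ultimately show "order_type m h y \<in> order_types m h \<and> weakly_ordered (order_type m h y) x" by simp
qed

text \<open>A B_h-set orders any two distinct index sequences strictly. Its inequalities therefore
  leave \<open>x\<close> no room for a tie or for a further inequality.\<close>

lemma order_typeI:
  assumes w: "Bh_set m h t w" and x: "\<And>r s. (r, s) \<in> order_type m h w \<Longrightarrow> mark_sum x r < mark_sum x s"
  shows "order_type m h x = order_type m h w"
    and "\<And>r s. r \<in> index_seqs m h \<Longrightarrow> s \<in> index_seqs m h \<Longrightarrow> r \<noteq> s \<Longrightarrow> mark_sum x r \<noteq> mark_sum x s"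
proof -
  have tri: "(r, s) \<in> order_type m h w \<or> (s, r) \<in> order_type m h w"
    if "r \<in> index_seqs m h" "s \<in> index_seqs m h" "r \<noteq> s" for r s
    using w that by (fastforce simp: Bh_set_def order_type_def)
  show "mark_sum x r \<noteq> mark_sum x s" if "r \<in> index_seqs m h" "s \<in> index_seqs m h" "r \<noteq> s" for r s
    using tri[OF that] x by fastforce
  have "(r, s) \<in> order_type m h w" if "(r, s) \<in> order_type m h x" for r s
    using that tri[of r s] x[of s r] by (force simp: order_type_def)
  then show "order_type m h x = order_type m h w"
    using x by (auto simp: order_type_def)
qed

text \<open>A B_h-set \<open>w\<close> of type \<open>S\<close> is rescaled to length
  \<open>t\<close> and joined to \<open>x\<close> by a segment. A weak inequality plus a positive
  multiple of a strict one is strict, so points of the segment arbitrarily close to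
  \<open>x\<close>, but different from the end \<open>x\<close>, have type \<open>S\<close>.\<close>

lemma order_types_near_superset:
  assumes x: "weak_ruler m t x" and t: "t > 0" and \<epsilon>: "0 < \<epsilon>"
  shows "{S \<in> order_types m h. weakly_ordered S x} \<subseteq> order_type m h ` Bh_sets_near m h t x \<epsilon>"
proof clarify
  fix S assume "S \<in> order_types m h" and S: "weakly_ordered S x"
  then obtain w :: "real list" and u where w: "Bh_set m h u w" "S = order_type m h w" unfolding order_types_def by blast
  have len: "length x = m + 1" "length w = m + 1" and ends: "x ! 0 = 0" "x ! m = t" "w ! 0 = 0" "w ! m = u"
    using x w by (auto simp: weak_ruler_def Bh_set_def ruler_def)
  have w_mono: "w ! i < w ! j" if "i < j" "j \<le> m" for i j
    using w(1) that by (auto simp: Bh_set_def ruler_def intro: sorted_wrt_nth_less)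
  have x_mono: "x ! i \<le> x ! j" if "i < j" "j \<le> m" for i j
    using x that by (auto simp: weak_ruler_def intro: sorted_wrt_nth_less)
  have "m \<noteq> 0" using ends t by (cases m) auto
  then have u: "u > 0" using w_mono[of 0 m] ends by simp
  \<comment> \<open>The factor that gives \<open>w\<close> the length \<open>t\<close>, so that the
    whole segment consists of rulers of that length.\<close>
  define a where "a = of_int t / u"
  have a: "a > 0" using t u by (simp add: a_def)
  define N where "N = L2_set (\<lambda>i. a * w ! i - real_of_int (x ! i)) {0..m}"
  \<comment> \<open>The distance to \<open>x\<close> will be \<open>\<sigma> * N\<close>. The bound
    1 keeps the weight of \<open>x\<close> nonnegative, and \<open>N + 1\<close> avoids division by
    0.\<close>
  define \<sigma> where "\<sigma> = min 1 (\<epsilon> / (N + 1))"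
  have N: "N \<ge> 0" unfolding N_def by (rule L2_set_nonneg)
  then have \<sigma>: "0 < \<sigma>" "\<sigma> \<le> 1" using \<epsilon> by (auto simp: \<sigma>_def)
  have "\<sigma> * N < \<sigma> * (N + 1)" using \<sigma> by simp
  also have "\<dots> \<le> \<epsilon> / (N + 1) * (N + 1)" using N by (intro mult_right_mono) (auto simp: \<sigma>_def)
  also have "\<dots> = \<epsilon>" using N by simp
  finally have \<sigma>N: "\<sigma> * N < \<epsilon>" .
  define y where "y = map (\<lambda>i. (1 - \<sigma>) * real_of_int (x ! i) + \<sigma> * a * w ! i) [0..<m + 1]"
  have y_nth: "y ! i = (1 - \<sigma>) * real_of_int (x ! i) + \<sigma> * a * w ! i" if "i \<le> m" for i
    unfolding y_def using that by (subst nth_map) (auto simp del: upt_Suc)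
  have y_sum: "mark_sum y r = (1 - \<sigma>) * of_int (mark_sum x r) + \<sigma> * a * mark_sum w r" if "set r \<subseteq> {0..m}" for r
    using that by (induction r) (auto simp: mark_sum_def y_nth algebra_simps)
  have less: "mark_sum y r < mark_sum y s" if rs: "(r, s) \<in> order_type m h w" for r s
  proof -
    have "set r \<subseteq> {0..m}" "set s \<subseteq> {0..m}" "mark_sum w r < mark_sum w s"
      using rs by (auto simp: order_type_def index_seqs_def)
    moreover have "mark_sum x r \<le> mark_sum x s" using S rs w(2) by (auto simp: weakly_ordered_def)
    ultimately show ?thesis using \<sigma> a
      by (simp add: y_sum) (intro add_le_less_mono mult_left_mono mult_strict_left_mono; simp)
  qed
  note ot = order_typeI[OF w(1) less]
  have "sorted_wrt (<) y" unfolding sorted_wrt_iff_nth_less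
  proof (intro allI impI)
    fix i j assume ij: "i < j" "j < length y"
    then have j: "j \<le> m" by (simp add: y_def)
    have "real_of_int (x ! i) \<le> of_int (x ! j)" "w ! i < w ! j"
      using x_mono w_mono ij(1) j by auto
    then show "y ! i < y ! j" using \<sigma> a j ij(1)
      by (simp add: y_nth) (intro add_le_less_mono mult_left_mono mult_strict_left_mono; simp)
  qed
  moreover have "y ! 0 = 0" "y ! m = of_int t"
    using ends u by (simp_all add: y_nth a_def field_simps)
  ultimately have "Bh_set m h (of_int t) y"
    unfolding Bh_set_def ruler_def using ot(2) by (auto simp: y_def)
  moreover have "L2_set (\<lambda>i. y ! i - real_of_int (x ! i)) {0..m} = \<sigma> * N"
  proof -
    have "L2_set (\<lambda>i. y ! i - real_of_int (x ! i)) {0..m} =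
        L2_set (\<lambda>i. \<sigma> * (a * w ! i - real_of_int (x ! i))) {0..m}"
      by (rule L2_set_cong) (auto simp: y_nth algebra_simps)
    then show ?thesis using \<sigma> by (simp add: N_def L2_set_right_distrib)
  qed
  ultimately have "y \<in> Bh_sets_near m h t x \<epsilon>" using \<sigma>N by (simp add: Bh_sets_near_def)
  then show "S \<in> order_type m h ` Bh_sets_near m h t x \<epsilon>" using ot(1) w(2) by blast
qed

text \<open>Both inclusions hold for all small \<open>\<epsilon>\<close>, so the number of types is
  eventually constant and equals the number of closed chambers containing \<open>x\<close>.\<close>

lemma Bh_multiplicity_eq:
  assumes x: "weak_ruler m t x" and t: "t > 0"
  shows "Bh_multiplicity m h t x = card {S \<in> order_types m h. weakly_ordered S x}"
proof -
  have len: "length x = m + 1" using x by (simp add: weak_ruler_def)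
  \<comment> \<open>Below this bound \<open>\<epsilon> * (2 * real h) < 1\<close> holds; the added 1
    keeps the denominator positive for every \<open>h\<close>.\<close>
  have eq: "card (comb_types m h (Bh_sets_near m h t x \<epsilon>)) = card {S \<in> order_types m h. weakly_ordered S x}"
    if "0 < \<epsilon>" "\<epsilon> < 1 / (2 * real h + 1)" for \<epsilon>
  proof -
    have "\<epsilon> * (2 * real h) \<le> \<epsilon> * (2 * real h + 1)" using that by simp
    also have "\<dots> < 1" using that by (simp add: field_simps)
    finally have "order_type m h ` Bh_sets_near m h t x \<epsilon> = {S \<in> order_types m h. weakly_ordered S x}"
      using order_types_near_subset[OF len that(1)] order_types_near_superset[OF x t that(1)] by blast
    then show ?thesis by (subst card_comb_types) (auto simp: Bh_sets_near_def)
  qed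
  have ev: "\<forall>\<^sub>F \<epsilon> in at_right 0. card (comb_types m h (Bh_sets_near m h t x \<epsilon>)) =
      card {S \<in> order_types m h. weakly_ordered S x}"
    unfolding eventually_at_right_field
    by (intro exI[of _ "1 / (2 * real h + 1)"] conjI) (auto intro!: eq simp: add_pos_nonneg)
  show ?thesis unfolding Bh_multiplicity_def
  proof (rule the_equality[where P = "\<lambda>n. \<forall>\<^sub>F \<epsilon> in at_right 0. card (comb_types m h (Bh_sets_near m h t x \<epsilon>)) = n", OF ev])
    fix n assume "\<forall>\<^sub>F \<epsilon> in at_right 0. card (comb_types m h (Bh_sets_near m h t x \<epsilon>)) = n"
    with ev have "\<forall>\<^sub>F \<epsilon>::real in at_right 0. n = card {S \<in> order_types m h. weakly_ordered S x}"
      by eventually_elim simp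
    then show "n = card {S \<in> order_types m h. weakly_ordered S x}"
      by (simp add: trivial_limit_at_right_real eventually_const)
  qed
qed

section \<open>Gap coordinates\<close>

text \<open>The value 0 from \<open>m\<close> on places the gaps of an integral ruler in
  \<open>lattice m\<close>.\<close>

definition gaps :: "nat \<Rightarrow> real list \<Rightarrow> nat \<Rightarrow> real" where
  "gaps m x k = (if k < m then x ! (k + 1) - x ! k else 0)"

text \<open>The coefficient of gap \<open>k\<close> in \<open>mark_sum x r\<close>: marking
  \<open>i\<close> is a sum of gaps, and gap \<open>k\<close> is among them exactly when
  \<open>k < i\<close>.\<close>

definition tail_count :: "nat list \<Rightarrow> nat \<Rightarrow> nat" where
  "tail_count r k = length (filter (\<lambda>i. k < i) r)"

definition order_form :: "nat list \<times> nat list \<Rightarrow> nat \<Rightarrow> real" where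
  "order_form = (\<lambda>(r, s) k. real (tail_count s k) - real (tail_count r k))"

definition chamber_forms :: "nat \<Rightarrow> (nat list \<times> nat list) set \<Rightarrow> (nat \<Rightarrow> real) set" where
  "chamber_forms m S = unit_form ` {..<m} \<union> order_form ` S"

lemma nth_eq_sum_gaps:
  assumes "x ! 0 = 0"
  shows "i \<le> m \<Longrightarrow> x ! i = (\<Sum>k<i. gaps m x k)"
  by (induction i) (auto simp: gaps_def assms)

lemma mark_sum_eq_ev:
  assumes "x ! 0 = 0" "set r \<subseteq> {0..m}"
  shows "mark_sum x r = ev m (\<lambda>k. real (tail_count r k)) (gaps m x)"
  using assms(2)
proof (induction r)
  case (Cons a r)
  have "ev m (\<lambda>k. real (tail_count (a # r) k)) (gaps m x) =
      ev m (\<lambda>k. (if k < a then 1 else 0) + real (tail_count r k)) (gaps m x)"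
    by (rule ev_cong) (auto simp: tail_count_def)
  also have "\<dots> = ev m (\<lambda>k. if k < a then 1 else 0) (gaps m x) + mark_sum x r"
    using Cons by (simp add: ev_add_left)
  also have "ev m (\<lambda>k. if k < a then 1 else 0) (gaps m x) = (\<Sum>k\<in>{k\<in>{..<m}. k < a}. gaps m x k)"
    unfolding ev_def by (subst sum.inter_filter) (auto intro: sum.cong)
  also have "{k\<in>{..<m}. k < a} = {..<a}" using Cons.prems by auto
  also have "(\<Sum>k<a. gaps m x k) = x ! a"
    using Cons.prems by (simp add: nth_eq_sum_gaps[OF assms(1), of a m])
  finally show ?case by (simp add: mark_sum_def)
qed (simp add: mark_sum_def tail_count_def ev_def)

lemma ev_order_form:
  assumes "x ! 0 = 0" "r \<in> index_seqs m h" "s \<in> index_seqs m h"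
  shows "ev m (order_form (r, s)) (gaps m x) = mark_sum x s - mark_sum x r"
proof -
  have "set r \<subseteq> {0..m}" "set s \<subseteq> {0..m}" using assms(2,3) by (auto simp: index_seqs_def)
  then show ?thesis using assms(1) by (simp add: order_form_def ev_diff_left mark_sum_eq_ev[where m = m])
qed

lemma sorted_wrt_less_iff_gaps:
  "length x = m + 1 \<Longrightarrow> sorted_wrt (<) x \<longleftrightarrow> (\<forall>k<m. gaps m x k > 0)"
  by (auto simp: sorted_wrt_iff_nth_Suc_transp gaps_def)

lemma sorted_wrt_le_iff_gaps:
  "length x = m + 1 \<Longrightarrow> sorted_wrt (\<le>) x \<longleftrightarrow> (\<forall>k<m. gaps m x k \<ge> 0)"
  by (auto simp: sorted_wrt_iff_nth_Suc_transp gaps_def)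

lemma order_types_subset: "S \<in> order_types m h \<Longrightarrow> S \<subseteq> index_seqs m h \<times> index_seqs m h"
  by (auto simp: order_types_def order_type_def)

text \<open>The unit forms express that the markings increase, the order forms express the
  inequalities in \<open>S\<close>. By \<open>order_typeI\<close> the latter already give the
  B_h-property and the exact order type.\<close>

lemma Bh_set_iff_chamber:
  assumes S: "S \<in> order_types m h" and x: "length x = m + 1" "x ! 0 = 0"
  shows "(\<forall>c\<in>chamber_forms m S. ev m c (gaps m x) > 0) \<longleftrightarrow>
    Bh_set m h (x ! m) x \<and> order_type m h x = S"
proof -
  obtain w :: "real list" and u where w: "Bh_set m h u w" "S = order_type m h w"
    using S unfolding order_types_def by blast
  have "(\<forall>c\<in>order_form ` S. ev m c (gaps m x) > 0) \<longleftrightarrow> (\<forall>(r, s)\<in>S. mark_sum x r < mark_sum x s)"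
    using order_types_subset[OF S] by (force simp: ev_order_form[OF x(2)])
  moreover have "(\<forall>c\<in>unit_form ` {..<m}. ev m c (gaps m x) > 0) \<longleftrightarrow> sorted_wrt (<) x"
    using x by (auto simp: sorted_wrt_less_iff_gaps ev_unit_form)
  ultimately have *: "(\<forall>c\<in>chamber_forms m S. ev m c (gaps m x) > 0) \<longleftrightarrow>
      sorted_wrt (<) x \<and> (\<forall>(r, s)\<in>S. mark_sum x r < mark_sum x s)"
    unfolding chamber_forms_def ball_Un by blast
  show ?thesis
  proof
    assume "\<forall>c\<in>chamber_forms m S. ev m c (gaps m x) > 0"
    then have "sorted_wrt (<) x"
      and less: "\<And>r s. (r, s) \<in> order_type m h w \<Longrightarrow> mark_sum x r < mark_sum x s"
      using * w(2) by auto
    then show "Bh_set m h (x ! m) x \<and> order_type m h x = S"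
      using order_typeI[OF w(1) less] x w(2) by (auto simp: Bh_set_def ruler_def)
  next
    assume "Bh_set m h (x ! m) x \<and> order_type m h x = S"
    then show "\<forall>c\<in>chamber_forms m S. ev m c (gaps m x) > 0"
      unfolding * by (auto simp: Bh_set_def ruler_def order_type_def)
  qed
qed

lemma weak_ruler_iff_chamber:
  assumes S: "S \<in> order_types m h" and x: "length x = m + 1" "x ! 0 = 0"
  shows "(\<forall>c\<in>chamber_forms m S. ev m c (gaps m x) \<ge> 0) \<longleftrightarrow>
    weak_ruler m (x ! m) x \<and> weakly_ordered S x"
proof -
  have "(\<forall>c\<in>order_form ` S. ev m c (gaps m x) \<ge> 0) \<longleftrightarrow> weakly_ordered S x"
    using order_types_subset[OF S] by (force simp: ev_order_form[OF x(2)] weakly_ordered_def)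
  moreover have "(\<forall>c\<in>unit_form ` {..<m}. ev m c (gaps m x) \<ge> 0) \<longleftrightarrow> sorted_wrt (\<le>) x"
    using x by (auto simp: sorted_wrt_le_iff_gaps ev_unit_form)
  ultimately show ?thesis using x unfolding chamber_forms_def ball_Un weak_ruler_def by blast
qed

lemma weak_ruler_of_int: "weak_ruler m (of_int t) (map real_of_int x) \<longleftrightarrow> weak_ruler m t x"
  by (cases "length x = m + 1") (auto simp: weak_ruler_def sorted_wrt_map)

lemma weakly_ordered_of_int:
  assumes "S \<in> order_types m h" "length x = m + 1"
  shows "weakly_ordered S (map real_of_int x) \<longleftrightarrow> weakly_ordered S x"
  unfolding weakly_ordered_def
proof (intro ball_cong refl, clarify)
  fix r s assume "(r, s) \<in> S"
  then have "set r \<subseteq> {0..m}" "set s \<subseteq> {0..m}"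
    using order_types_subset[OF assms(1)] by (auto simp: index_seqs_def)
  then show "(mark_sum (map real_of_int x) r \<le> mark_sum (map real_of_int x) s) =
      (mark_sum x r \<le> mark_sum x s)"
    by (simp add: mark_sum_of_int[OF assms(2)])
qed

text \<open>The inverse takes partial sums of the gaps. These are integers, so the floor only
  changes the type.\<close>

lemma bij_betw_gaps:
  "bij_betw (\<lambda>x. gaps m (map real_of_int x)) {x. length x = m + 1 \<and> x ! 0 = 0 \<and> x ! m = t}
    {z \<in> lattice m. (\<Sum>k<m. z k) = of_int t}"
proof (rule bij_betwI[where g = "\<lambda>z. map (\<lambda>i. \<lfloor>\<Sum>k<i. z k\<rfloor>) [0..<m + 1]"])
  let ?g = "\<lambda>z. map (\<lambda>i. \<lfloor>\<Sum>k<i. z k :: real\<rfloor>) [0..<m + 1]"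
  have nth: "real_of_int (?g z ! i) = (\<Sum>k<i. z k)" if "z \<in> lattice m" "i \<le> m" for z i
  proof -
    have "(\<Sum>k<i. z k) \<in> \<int>" using that by (auto simp: lattice_def intro!: Ints_sum)
    then have "real_of_int \<lfloor>\<Sum>k<i. z k\<rfloor> = (\<Sum>k<i. z k)" by (auto elim: Ints_cases)
    moreover have "?g z ! i = \<lfloor>\<Sum>k<i. z k\<rfloor>" using that by (simp del: upt_Suc)
    ultimately show ?thesis by simp
  qed
  show "(\<lambda>x. gaps m (map real_of_int x)) \<in> {x. length x = m + 1 \<and> x ! 0 = 0 \<and> x ! m = t} \<rightarrow>
      {z \<in> lattice m. (\<Sum>k<m. z k) = of_int t}"
  proof (clarify, intro conjI)
    fix x :: "int list" assume x: "length x = m + 1" "x ! 0 = 0"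
    then have "map real_of_int x ! 0 = 0" by simp
    from nth_eq_sum_gaps[OF this, of m m]
    show "(\<Sum>k<m. gaps m (map real_of_int x) k) = of_int (x ! m)" using x by simp
    show "gaps m (map real_of_int x) \<in> lattice m" using x by (auto simp: lattice_def gaps_def)
  qed
  show "?g \<in> {z \<in> lattice m. (\<Sum>k<m. z k) = of_int t} \<rightarrow> {x. length x = m + 1 \<and> x ! 0 = 0 \<and> x ! m = t}"
  proof clarify
    fix z assume z: "z \<in> lattice m" "(\<Sum>k<m. z k) = real_of_int t"
    have "real_of_int (?g z ! 0) = of_int 0" "real_of_int (?g z ! m) = of_int t"
      using nth[OF z(1), of 0] nth[OF z(1), of m] z(2) by (simp_all del: upt_Suc)
    then show "length (?g z) = m + 1 \<and> ?g z ! 0 = 0 \<and> ?g z ! m = t"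
      by (simp only: of_int_eq_iff) simp
  qed
  show "?g (gaps m (map real_of_int x)) = x" if "x \<in> {x. length x = m + 1 \<and> x ! 0 = 0 \<and> x ! m = t}" for x
  proof (rule nth_equalityI)
    show "length (?g (gaps m (map real_of_int x))) = length x" using that by simp
    fix i assume "i < length (?g (gaps m (map real_of_int x)))"
    then have i: "i \<le> m" by simp
    have "map real_of_int x ! 0 = 0" using that by simp
    from nth_eq_sum_gaps[OF this i] have "(\<Sum>k<i. gaps m (map real_of_int x) k) = real_of_int (x ! i)"
      using that i by simp
    then show "?g (gaps m (map real_of_int x)) ! i = x ! i" using i by (simp del: upt_Suc)
  qed
  show "gaps m (map real_of_int (?g z)) = z" if "z \<in> {z \<in> lattice m. (\<Sum>k<m. z k) = of_int t}" for z
  proof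
    fix k
    show "gaps m (map real_of_int (?g z)) k = z k"
    proof (cases "k < m")
      case True
      then have "gaps m (map real_of_int (?g z)) k = real_of_int (?g z ! (k + 1)) - real_of_int (?g z ! k)"
        by (simp add: gaps_def del: upt_Suc)
      also have "\<dots> = (\<Sum>k<k + 1. z k) - (\<Sum>k<k. z k)"
        by (subst (1 2) nth) (use True that in auto)
      finally show ?thesis by simp
    qed (use that in \<open>auto simp: gaps_def lattice_def\<close>)
  qed
qed

section \<open>Lattice points of open and closed chambers as rulers\<close>

lemma card_Collect_bij_betw:
  assumes "bij_betw f A B"
  shows "card {x \<in> A. P (f x)} = card {y \<in> B. P y}"
proof -
  have "{y \<in> B. P y} = f ` {x \<in> A. P (f x)}" using assms by (auto simp: bij_betw_def)
  moreover have "inj_on f {x \<in> A. P (f x)}"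
    using assms by (auto simp: bij_betw_def intro: inj_on_subset)
  ultimately show ?thesis by (simp add: card_image)
qed

lemma card_open_chamber:
  assumes S: "S \<in> order_types m h"
  shows "card {z \<in> lattice m. (\<forall>c\<in>chamber_forms m S. ev m c z > 0) \<and> (\<Sum>k<m. z k) = of_int t} =
    card {x :: int list. Bh_set m h t x \<and> order_type m h x = S}"
proof -
  have "Bh_set m h t x \<and> order_type m h x = S \<longleftrightarrow>
      x \<in> {x. length x = m + 1 \<and> x ! 0 = 0 \<and> x ! m = t} \<and>
      (\<forall>c\<in>chamber_forms m S. ev m c (gaps m (map real_of_int x)) > 0)" for x
  proof (cases "x \<in> {x. length x = m + 1 \<and> x ! 0 = 0 \<and> x ! m = t}")
    case True
    then have "map real_of_int x ! m = of_int t" by simp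
    then show ?thesis using True Bh_set_iff_chamber[OF S, of "map real_of_int x"]
      by (simp add: Bh_set_of_int order_type_of_int)
  qed (auto simp: Bh_set_def ruler_def)
  then have "{x :: int list. Bh_set m h t x \<and> order_type m h x = S} =
      {x \<in> {x. length x = m + 1 \<and> x ! 0 = 0 \<and> x ! m = t}.
        \<forall>c\<in>chamber_forms m S. ev m c (gaps m (map real_of_int x)) > 0}" by blast
  then show ?thesis
    using card_Collect_bij_betw[OF bij_betw_gaps[of m t], of "\<lambda>z. \<forall>c\<in>chamber_forms m S. ev m c z > 0"]
    by (simp only: mem_Collect_eq conj_ac)
qed

lemma card_closed_chamber:
  assumes S: "S \<in> order_types m h"
  shows "card {z \<in> lattice m. (\<forall>c\<in>chamber_forms m S. ev m c z \<ge> 0) \<and> (\<Sum>k<m. z k) = of_int t} =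
    card {x :: int list. weak_ruler m t x \<and> weakly_ordered S x}"
proof -
  have "weak_ruler m t x \<and> weakly_ordered S x \<longleftrightarrow>
      x \<in> {x. length x = m + 1 \<and> x ! 0 = 0 \<and> x ! m = t} \<and>
      (\<forall>c\<in>chamber_forms m S. ev m c (gaps m (map real_of_int x)) \<ge> 0)" for x
  proof (cases "x \<in> {x. length x = m + 1 \<and> x ! 0 = 0 \<and> x ! m = t}")
    case True
    then have "map real_of_int x ! m = of_int t" by simp
    then show ?thesis using True weak_ruler_iff_chamber[OF S, of "map real_of_int x"]
      by (simp add: weak_ruler_of_int weakly_ordered_of_int[OF S])
  qed (auto simp: weak_ruler_def)
  then have "{x :: int list. weak_ruler m t x \<and> weakly_ordered S x} =
      {x \<in> {x. length x = m + 1 \<and> x ! 0 = 0 \<and> x ! m = t}.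
        \<forall>c\<in>chamber_forms m S. ev m c (gaps m (map real_of_int x)) \<ge> 0}" by blast
  then show ?thesis
    using card_Collect_bij_betw[OF bij_betw_gaps[of m t], of "\<lambda>z. \<forall>c\<in>chamber_forms m S. ev m c z \<ge> 0"]
    by (simp only: mem_Collect_eq conj_ac)
qed

lemma chamber_forms_point:
  assumes "S \<in> order_types m h"
  obtains y where "\<And>c. c \<in> chamber_forms m S \<Longrightarrow> ev m c y > 0"
proof -
  obtain w :: "real list" and u where w: "Bh_set m h u w" "S = order_type m h w"
    using assms unfolding order_types_def by blast
  then have "length w = m + 1" "w ! 0 = 0" "w ! m = u" by (auto simp: Bh_set_def ruler_def)
  then show ?thesis using Bh_set_iff_chamber[OF assms, of w] w that by blast
qed

text \<open>The form is positive somewhere, namely at the gaps of a B_h-set of type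
  \<open>S\<close>, hence nonzero; its coefficients are differences of naturals.\<close>

lemma order_form_rational_nonzero:
  assumes "S \<in> order_types m h" "f \<in> order_form ` S"
  shows "(\<forall>k<m. f k \<in> \<rat>) \<and> (\<exists>k<m. f k \<noteq> 0)"
proof -
  obtain r s where rs: "(r, s) \<in> S" "f = order_form (r, s)" using assms(2) by auto
  obtain y where "\<And>c. c \<in> chamber_forms m S \<Longrightarrow> ev m c y > 0"
    using chamber_forms_point[OF assms(1)] by blast
  then have "ev m f y \<noteq> 0" using assms(2) by (force simp: chamber_forms_def)
  then have "\<exists>k<m. f k \<noteq> 0" by (rule ev_nonzeroD)
  moreover have "\<forall>k<m. f k \<in> \<rat>" unfolding rs(2) order_form_def by auto
  ultimately show ?thesis by blast
qed

lemma order_type_reciprocity: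
  assumes m: "m \<ge> 1" and S: "S \<in> order_types m h"
  shows "\<exists>q. quasipolynomial q \<and>
    (\<forall>t>0. q t = real (card {x :: int list. Bh_set m h t x \<and> order_type m h x = S})) \<and>
    (\<forall>t\<ge>0. real (card {x :: int list. weak_ruler m t x \<and> weakly_ordered S x}) = (-1) ^ (m - 1) * q (- t))"
proof -
  have "finite S"
    using order_types_subset[OF S] finite_index_seqs by (meson finite_SigmaI finite_subset)
  then have G: "finite (order_form ` S)" by simp
  obtain y where "\<And>c. c \<in> chamber_forms m S \<Longrightarrow> ev m c y > 0"
    using chamber_forms_point[OF S] by blast
  from chamber_reciprocity[OF m G order_form_rational_nonzero[OF S] chamber_forms_def this]
  show ?thesis unfolding card_open_chamber[OF S] card_closed_chamber[OF S] by blast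
qed

section \<open>Finiteness, integral representatives and length 0\<close>

lemma finite_weak_rulers: "finite {x :: int list. weak_ruler m t x}"
proof (rule finite_subset)
  show "{x. weak_ruler m t x} \<subseteq> {x. set x \<subseteq> {0..t} \<and> length x = m + 1}"
  proof (clarify, intro conjI subsetI)
    fix x a assume x: "weak_ruler m t x" and "a \<in> set x"
    then obtain i where i: "i \<le> m" "a = x ! i" by (auto simp: in_set_conv_nth weak_ruler_def less_Suc_eq_le)
    have "x ! i \<le> x ! j" if "i \<le> j" "j \<le> m" for i j
      using x that by (auto simp: weak_ruler_def intro: sorted_nth_mono)
    from this[of 0 i] this[of i m] show "a \<in> {0..t}" using x i by (auto simp: weak_ruler_def)
  qed (simp add: weak_ruler_def)
qed (rule finite_lists_length_eq, simp)

text \<open>Every open chamber contains a lattice point, so integral B_h-sets realize all the types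
  of real ones.\<close>

lemma order_types_integral:
  "order_types m h = order_type m h ` {map real_of_int x | x. \<exists>t::int. Bh_set m h t x}"
proof
  show "order_type m h ` {map real_of_int x | x. \<exists>t::int. Bh_set m h t x} \<subseteq> order_types m h"
    unfolding order_types_def using Bh_set_of_int by blast
  show "order_types m h \<subseteq> order_type m h ` {map real_of_int x | x. \<exists>t::int. Bh_set m h t x}"
  proof
    fix S assume S: "S \<in> order_types m h"
    have "finite (chamber_forms m S)" unfolding chamber_forms_def
      using order_types_subset[OF S] finite_index_seqs by (meson finite_SigmaI finite_UnI finite_imageI finite_lessThan finite_subset)
    moreover obtain y where "\<And>c. c \<in> chamber_forms m S \<Longrightarrow> ev m c y > 0"
      using chamber_forms_point[OF S] by blast
    ultimately obtain z where z: "z \<in> lattice m" "\<forall>c\<in>chamber_forms m S. ev m c z > 0"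
      using exists_lattice_pos by blast
    have "(\<Sum>k<m. z k) \<in> \<int>" using z(1) by (auto simp: lattice_def intro!: Ints_sum)
    then obtain t where t: "(\<Sum>k<m. z k) = of_int t" by (auto elim: Ints_cases)
    then obtain x where x: "length x = m + 1" "x ! 0 = 0" "x ! m = t" "z = gaps m (map real_of_int x)"
      using bij_betw_gaps[of m t] z(1) unfolding bij_betw_def by blast
    then have "Bh_set m h t x \<and> order_type m h x = S"
      using Bh_set_iff_chamber[OF S, of "map real_of_int x"] z(2)
      by (simp add: Bh_set_of_int order_type_of_int)
    then show "S \<in> order_type m h ` {map real_of_int x | x. \<exists>t::int. Bh_set m h t x}"
      using order_type_of_int[OF x(1)] by blast
  qed
qed

text \<open>The markings are squeezed between 0 and 0, and at the zero ruler all sums tie, which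
  satisfies every weak inequality. Each closed chamber thus contributes 1 at height 0.\<close>

lemma weak_ruler_0_iff:
  "weak_ruler m (0::int) x \<and> weakly_ordered S x \<longleftrightarrow> x = replicate (m + 1) 0"
    if "S \<in> order_types m h" for S
proof
  assume "weak_ruler m 0 x \<and> weakly_ordered S x"
  then have x: "weak_ruler m 0 x" ..
  show "x = replicate (m + 1) 0"
  proof (rule nth_equalityI)
    show "length x = length (replicate (m + 1) (0::int))" using x by (simp add: weak_ruler_def)
    fix i assume "i < length x"
    then have i: "i \<le> m" using x by (simp add: weak_ruler_def)
    have "x ! i \<le> x ! j" if "i \<le> j" "j \<le> m" for i j
      using x that by (auto simp: weak_ruler_def intro: sorted_nth_mono)
    from this[of 0 i] this[of i m] show "x ! i = replicate (m + 1) 0 ! i"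
      using x i by (simp add: weak_ruler_def del: replicate_Suc)
  qed
next
  assume x: "x = replicate (m + 1) 0"
  have "mark_sum x r = 0" if "set r \<subseteq> {0..m}" for r
    using that unfolding x by (induction r) (auto simp: mark_sum_def simp del: replicate_Suc)
  then have "weakly_ordered S x"
    using order_types_subset[OF that] by (force simp: weakly_ordered_def index_seqs_def)
  moreover have "weak_ruler m 0 x" unfolding x weak_ruler_def sorted_wrt_iff_nth_less
    by (simp del: replicate_Suc)
  ultimately show "weak_ruler m 0 x \<and> weakly_ordered S x" by simp
qed

section \<open>Summation over all chambers\<close>

theorem theorem2p5:
  fixes h m :: nat
  assumes "h \<ge> 2" and "m \<ge> 1"
  shows "(\<forall>t::int. t > 0 \<longrightarrow>
            (-1) ^ (m - 1) * Bh_quasipoly m h (- t) =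
              real (\<Sum>x | weak_ruler m t x. Bh_multiplicity m h t x)) \<and>
         (-1) ^ (m - 1) * Bh_quasipoly m h 0 =
           real (card (comb_types m h {map real_of_int x | x. \<exists>t::int. Bh_set m h t x}))"
proof -
  have "\<forall>S\<in>order_types m h. \<exists>q. quasipolynomial q \<and>
    (\<forall>t>0. q t = real (card {x :: int list. Bh_set m h t x \<and> order_type m h x = S})) \<and>
    (\<forall>t\<ge>0. real (card {x :: int list. weak_ruler m t x \<and> weakly_ordered S x}) = (-1) ^ (m - 1) * q (- t))"
    using order_type_reciprocity[OF assms(2)] by (rule ballI)
  from bchoice[OF this] obtain q where q: "\<And>S. S \<in> order_types m h \<Longrightarrow> quasipolynomial (q S)"
    "\<And>S t. S \<in> order_types m h \<Longrightarrow> t > 0 \<Longrightarrow>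
      q S t = real (card {x :: int list. Bh_set m h t x \<and> order_type m h x = S})"
    "\<And>S t. S \<in> order_types m h \<Longrightarrow> t \<ge> 0 \<Longrightarrow>
      real (card {x :: int list. weak_ruler m t x \<and> weakly_ordered S x}) = (-1) ^ (m - 1) * q S (- t)"
    by blast
  define Q where "Q t = (\<Sum>S\<in>order_types m h. q S t)" for t
  have Q_quasi: "quasipolynomial Q"
    unfolding Q_def using q(1) by (rule quasipolynomial_sum)
  have Q_pos: "Q t = real (num_Bh_sets m h t)" if t: "t > 0" for t
  proof -
    let ?B = "{x :: int list. Bh_set m h t x}"
    have fin: "finite ?B"
      by (rule finite_subset[OF _ finite_weak_rulers[of m t]])
        (auto simp: Bh_set_def ruler_def weak_ruler_def intro: strict_sorted_imp_sorted)
    have types: "order_type m h ` ?B \<subseteq> order_types m h"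
    proof clarify
      fix x :: "int list" assume x: "Bh_set m h t x"
      then have "order_type m h x = order_type m h (map real_of_int x)"
        by (simp add: order_type_of_int Bh_set_def ruler_def)
      then show "order_type m h x \<in> order_types m h"
        unfolding order_types_def using x Bh_set_of_int by blast
    qed
    \<comment> \<open>Each integral B_h-set lies in exactly one open chamber, the one of its order
      type.\<close>
    have "num_Bh_sets m h t = (\<Sum>S\<in>order_types m h. card {x \<in> ?B. order_type m h x = S})"
      using sum.group[OF fin finite_order_types types, of "\<lambda>_. 1 :: nat"] by (simp add: num_Bh_sets_def)
    then show ?thesis by (simp add: Q_def q(2) t)
  qed
  have Bh_Q: "Bh_quasipoly m h = Q"
    unfolding Bh_quasipoly_def
    by (rule the_equality) (use Q_quasi Q_pos quasipolynomial_unique in auto)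
  have Q_neg: "(-1) ^ (m - 1) * Q (- t) =
      real (\<Sum>S\<in>order_types m h. card {x :: int list. weak_ruler m t x \<and> weakly_ordered S x})"
    if "t \<ge> 0" for t
    using q(3) that by (simp add: Q_def sum_distrib_left)
  have "(-1) ^ (m - 1) * Bh_quasipoly m h (- t) =
      real (\<Sum>x | weak_ruler m t x. Bh_multiplicity m h t x)" if t: "t > 0" for t
  proof -
    let ?W = "{x :: int list. weak_ruler m t x}"
    \<comment> \<open>Double counting of the pairs of a closed chamber and a ruler contained in
      it.\<close>
    have "(\<Sum>S\<in>order_types m h. card {x \<in> ?W. weakly_ordered S x}) =
        (\<Sum>S\<in>order_types m h. \<Sum>x\<in>?W. if weakly_ordered S x then 1 else 0)"
      by (simp only: card_eq_sum sum.inter_filter[OF finite_weak_rulers])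
    also have "\<dots> = (\<Sum>x\<in>?W. card {S \<in> order_types m h. weakly_ordered S x})"
      by (subst sum.swap) (simp only: card_eq_sum sum.inter_filter[OF finite_order_types])
    also have "\<dots> = (\<Sum>x\<in>?W. Bh_multiplicity m h t x)"
      by (rule sum.cong) (simp_all add: Bh_multiplicity_eq t)
    finally show ?thesis using Q_neg[of t] t by (simp add: Bh_Q)
  qed
  moreover have "(-1) ^ (m - 1) * Bh_quasipoly m h 0 =
      real (card (comb_types m h {map real_of_int x | x. \<exists>t::int. Bh_set m h t x}))"
  proof -
    have "card {x :: int list. weak_ruler m 0 x \<and> weakly_ordered S x} = 1" if "S \<in> order_types m h" for S
      unfolding weak_ruler_0_iff[OF that] by simp
    then have "(-1) ^ (m - 1) * Bh_quasipoly m h 0 = real (card (order_types m h))"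
      using Q_neg[of 0] by (simp add: Bh_Q)
    also have "order_types m h = order_type m h ` {map real_of_int x | x. \<exists>t::int. Bh_set m h t x}"
      by (rule order_types_integral)
    also have "card \<dots> = card (comb_types m h {map real_of_int x | x. \<exists>t::int. Bh_set m h t x})"
      by (rule card_comb_types[symmetric]) (use Bh_set_of_int in blast)
    finally show ?thesis .
  qed
  ultimately show ?thesis by blast
qed

end
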